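(* Let $X=\{X_1,X_2,\dots\}$ be a real-valued Gaussian stationary process with autocovariance function $r$, such that the sequence $\{|r(n)|\}_{n}$ is decreasing (i.e. nonincreasing). Suppose the spectral density $f(\lambda)$ of $X$ is continuous and $f(\lambda)>0$ for all $\lambda$. If $$\sum_{n}|r(n)|<\infty,$$ then the excess entropy $E$ of $X$ is finite.
   Context: For a stationary Gaussian process, $r(n)=\mathbb{E}[(X_{k+n}-\mathbb{E}X_{k+n})(X_k-\mathbb{E}X_k)]$ denotes the autocovariance at lag $n$ (independent of $k$). The spectral density $f$ is the $2\pi$-periodic function with $f(\lambda)=\sum_{n=-\infty}^{\infty}r(n)e^{in\lambda}$, equivalently $r(k)=\frac1{2\pi}\int_0^{2\pi}f(\lambda)e^{-i\lambda k}\,d\lambda$ for all integers $k$; continuity of $f$ is as a $2\pi$-periodic function. Differential block entropies: $H(n):=H(X_1,\dots,X_n)=-\int p_n\log p_n$, where $p_n$ is the joint density of $(X_1,\dots,X_n)$; for the Gaussian process this equals $\frac12\log\big((2\pi e)^n\det K^{(n)}\big)$ with $K^{(n)}=(r(i-j))_{1\le i,j\le n}$. Put $H(0):=0$, $h(n):=H(n)-H(n-1)$, and let the entropy rate be $h_\mu:=\lim_{n\to\infty}H(n)/n$. The excess entropy is $E:=\sum_{n=1}^\infty(h(n)-h_\mu)\in[0,+\infty]$. *)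

theory Defs
  imports "HOL-Probability.Probability"
begin

text \<open>A process is a family X 1, X 2, ... of real random variables on a probability space M;
  the variable X 0 plays no role.\<close>

text \<open>Gaussian process: every finite linear combination is normally distributed, where point
  masses count as (degenerate) normal distributions.\<close>

definition gaussian_rv :: "'a measure \<Rightarrow> ('a \<Rightarrow> real) \<Rightarrow> bool" where
  "gaussian_rv M Z \<longleftrightarrow>
     Z \<in> borel_measurable M \<and>
     ((\<exists>\<mu> \<sigma>. \<sigma> > 0 \<and> distributed M lborel Z (\<lambda>x. ennreal (normal_density \<mu> \<sigma> x))) \<or>
      (\<exists>\<mu>. AE \<omega> in M. Z \<omega> = \<mu>))"

definition gaussian_process :: "'a measure \<Rightarrow> (nat \<Rightarrow> 'a \<Rightarrow> real) \<Rightarrow> bool" where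
  "gaussian_process M X \<longleftrightarrow>
     (\<forall>J c. finite J \<and> J \<subseteq> {1..} \<longrightarrow> gaussian_rv M (\<lambda>\<omega>. \<Sum>j\<in>J. c j * X j \<omega>))"

definition stationary_process :: "'a measure \<Rightarrow> (nat \<Rightarrow> 'a \<Rightarrow> real) \<Rightarrow> bool" where
  "stationary_process M X \<longleftrightarrow>
     (\<forall>J h. finite J \<and> J \<subseteq> {1..} \<longrightarrow>
        distr M (PiM J (\<lambda>_. borel)) (\<lambda>\<omega>. \<lambda>j\<in>J. X (j + h) \<omega>) =
        distr M (PiM J (\<lambda>_. borel)) (\<lambda>\<omega>. \<lambda>j\<in>J. X j \<omega>))"

text \<open>Only lags n \<open>\<ge>\<close> 0 are recorded; the value at a negative lag n is r(-n).\<close>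

definition is_autocovariance :: "'a measure \<Rightarrow> (nat \<Rightarrow> 'a \<Rightarrow> real) \<Rightarrow> (nat \<Rightarrow> real) \<Rightarrow> bool" where
  "is_autocovariance M X r \<longleftrightarrow>
     (\<forall>k\<ge>1. \<forall>n. r n = (\<integral>\<omega>. (X (k + n) \<omega> - (\<integral>\<omega>'. X (k + n) \<omega>' \<partial>M)) *
                              (X k \<omega> - (\<integral>\<omega>'. X k \<omega>' \<partial>M)) \<partial>M))"

definition is_spectral_density :: "(nat \<Rightarrow> real) \<Rightarrow> (real \<Rightarrow> real) \<Rightarrow> bool" where
  "is_spectral_density r f \<longleftrightarrow>
     (\<forall>x. f (x + 2 * pi) = f x) \<and>
     set_integrable lborel {0..2 * pi} f \<and>
     (\<forall>k::int. complex_of_real (r (nat \<bar>k\<bar>)) =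
        1 / (2 * complex_of_real pi) *
        (LINT x:{0..2 * pi}|lborel.
           complex_of_real (f x) * exp (- (\<i> * complex_of_real x * of_int k))))"

text \<open>The library's \<open>entropy\<close> of a random variable with density p with respect to the reference
  measure is the integral of -p log p; here the reference measure is Lebesgue measure on the
  n-fold product and the logarithm is natural.\<close>

definition block_entropy :: "'a measure \<Rightarrow> (nat \<Rightarrow> 'a \<Rightarrow> real) \<Rightarrow> nat \<Rightarrow> real" where
  "block_entropy M X n =
     (if n = 0 then 0
      else prob_space.entropy M (exp 1) (PiM {1..n} (\<lambda>_. lborel)) (\<lambda>\<omega>. \<lambda>i\<in>{1..n}. X i \<omega>))"

definition entropy_increment :: "'a measure \<Rightarrow> (nat \<Rightarrow> 'a \<Rightarrow> real) \<Rightarrow> nat \<Rightarrow> real" where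
  "entropy_increment M X n = block_entropy M X n - block_entropy M X (n - 1)"

definition entropy_rate :: "'a measure \<Rightarrow> (nat \<Rightarrow> 'a \<Rightarrow> real) \<Rightarrow> real" where
  "entropy_rate M X = lim (\<lambda>n. block_entropy M X n / real n)"

text \<open>The series starts with the increment at n = 1. As \<open>lim\<close> and \<open>suminf\<close> are total, these two
  values are meaningful only when the limit and the series exist.\<close>

definition excess_entropy :: "'a measure \<Rightarrow> (nat \<Rightarrow> 'a \<Rightarrow> real) \<Rightarrow> ereal" where
  "excess_entropy M X = (\<Sum>n. ereal (entropy_increment M X (Suc n) - entropy_rate M X))"

end

theory Submission
  imports Defs
begin

text \<open>Write \<open>s k\<close> for the variance of the error of the best linear prediction of \<open>X k\<close> from
  \<open>X 1, ..., X (k - 1)\<close>. The chain rule gives the block entropy as the sum of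
  \<open>ln (2 \<pi> e s k) / 2\<close>, so everything comes down to the summability of \<open>s k - lim s\<close>. By
  stationarity \<open>s k - s (k + m)\<close> is the gain from adding the block \<open>X 1, ..., X m\<close> to the predictors
  of \<open>X (m + k)\<close>. As \<open>f\<close> is bounded below by some \<open>\<kappa> > 0\<close>, the covariance form dominates \<open>\<kappa>\<close>
  times the Euclidean norm, and Bessel's inequality for the innovations of the second block bounds
  the sum of the gains by \<open>r 0 / \<kappa>\<^sup>2\<close> times the sum of the squared covariances between the two
  blocks. Monotonicity of \<open>\<bar>r\<bar>\<close> gives \<open>(r (a + b))\<^sup>2 \<le> \<bar>r a\<bar> * \<bar>r b\<bar>\<close>, which makes this bound uniform
  in \<open>m\<close> and in the block length.\<close>

section \<open>Linear prediction for a coercive covariance kernel\<close>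

locale coercive_kernel =
  fixes \<rho> :: "'i \<Rightarrow> 'i \<Rightarrow> real" and \<kappa> :: real
  assumes sym: "\<rho> i j = \<rho> j i"
    and kappa_pos: "\<kappa> > 0"
    and coercive: "finite J \<Longrightarrow> \<kappa> * (\<Sum>i\<in>J. (c i)\<^sup>2) \<le> (\<Sum>i\<in>J. \<Sum>j\<in>J. c i * c j * \<rho> i j)"
begin

text \<open>When \<rho> is the covariance of a family of variables, this is the covariance of the
  linear combinations with coefficients \<open>c\<close> and \<open>d\<close>. Coefficients are
  total functions, so that one function can be read over different index sets.\<close>

definition form :: "'i set \<Rightarrow> ('i \<Rightarrow> real) \<Rightarrow> ('i \<Rightarrow> real) \<Rightarrow> real" where
  "form S c d = (\<Sum>i\<in>S. \<Sum>j\<in>S. c i * d j * \<rho> i j)"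

text \<open>Covariance of the combination \<open>c\<close> with the single variable
  \<open>l\<close>, which may lie outside \<open>S\<close>.\<close>

definition cov :: "'i set \<Rightarrow> ('i \<Rightarrow> real) \<Rightarrow> 'i \<Rightarrow> real" where
  "cov S c l = (\<Sum>i\<in>S. c i * \<rho> i l)"

section \<open>Algebra of the covariance form\<close>

lemma form_cov: "form S c d = (\<Sum>j\<in>S. d j * cov S c j)"
  unfolding form_def cov_def sum_distrib_left
  by (subst sum.swap) (simp add: mult_ac)

lemma form_commute: "form S c d = form S d c"
  unfolding form_def by (subst sum.swap) (simp add: mult_ac sym)

lemma form_add_left: "form S (\<lambda>i. c i + c' i) d = form S c d + form S c' d"
  by (simp add: form_def algebra_simps sum.distrib)

lemma form_diff_left: "form S (\<lambda>i. c i - c' i) d = form S c d - form S c' d"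
  by (simp add: form_def algebra_simps sum_subtractf)

lemma form_diff_right: "form S d (\<lambda>i. c i - c' i) = form S d c - form S d c'"
  by (simp add: form_def algebra_simps sum_subtractf)

lemma form_scale_left: "form S (\<lambda>i. a * c i) d = a * form S c d"
  by (simp add: form_def sum_distrib_left mult_ac)

lemma form_sum_left: "form S (\<lambda>i. \<Sum>k\<in>K. w k * c k i) d = (\<Sum>k\<in>K. w k * form S (c k) d)"
proof (induction K rule: infinite_finite_induct)
  case (insert k K)
  then show ?case
    by (simp add: form_add_left form_scale_left)
qed (simp_all add: form_def)

lemma cov_mono_neutral:
  assumes "finite S" "T \<subseteq> S" "\<And>i. i \<in> S - T \<Longrightarrow> c i = 0"
  shows "cov S c l = cov T c l"
  unfolding cov_def by (rule sum.mono_neutral_right) (use assms in auto)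

lemma form_mono_neutral:
  assumes "finite S" "T \<subseteq> S" "\<And>i. i \<in> S - T \<Longrightarrow> c i = 0" "\<And>i. i \<in> S - T \<Longrightarrow> d i = 0"
  shows "form S c d = form T c d"
proof -
  have "form S c d = (\<Sum>j\<in>T. d j * cov S c j)"
    unfolding form_cov by (rule sum.mono_neutral_right) (use assms in auto)
  also have "\<dots> = (\<Sum>j\<in>T. d j * cov T c j)"
    using cov_mono_neutral[OF assms(1-3)] by simp
  finally show ?thesis by (simp add: form_cov)
qed

lemma form_ge: "finite S \<Longrightarrow> \<kappa> * (\<Sum>i\<in>S. (c i)\<^sup>2) \<le> form S c c"
  unfolding form_def by (rule coercive)

text \<open>By coercivity and weighted AM-GM, the sum is at most half of the form plus half of the bound.\<close>

lemma form_le_dual: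
  assumes "finite S" "T \<subseteq> S" and eq: "form S c c = (\<Sum>j\<in>T. c j * g j)"
  shows "form S c c \<le> (\<Sum>j\<in>T. (g j)\<^sup>2) / \<kappa>"
proof -
  have "c j * g j \<le> \<kappa> / 2 * (c j)\<^sup>2 + (g j)\<^sup>2 / (2 * \<kappa>)" for j
  proof -
    have "0 \<le> (\<kappa> * c j - g j)\<^sup>2 / (2 * \<kappa>)" using kappa_pos by simp
    also have "\<dots> = \<kappa> / 2 * (c j)\<^sup>2 + (g j)\<^sup>2 / (2 * \<kappa>) - c j * g j"
      using kappa_pos by (simp add: field_simps power2_eq_square)
    finally show ?thesis by simp
  qed
  then have "form S c c \<le> (\<Sum>j\<in>T. \<kappa> / 2 * (c j)\<^sup>2 + (g j)\<^sup>2 / (2 * \<kappa>))"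
    unfolding eq by (intro sum_mono)
  also have "\<dots> = \<kappa> / 2 * (\<Sum>j\<in>T. (c j)\<^sup>2) + (\<Sum>j\<in>T. (g j)\<^sup>2) / (2 * \<kappa>)"
    by (simp add: sum.distrib sum_distrib_left sum_divide_distrib)
  also have "\<kappa> / 2 * (\<Sum>j\<in>T. (c j)\<^sup>2) \<le> \<kappa> / 2 * (\<Sum>j\<in>S. (c j)\<^sup>2)"
    using kappa_pos assms by (intro mult_left_mono sum_mono2) auto
  also have "\<dots> \<le> form S c c / 2"
    using form_ge[OF assms(1), of c] by simp
  finally show ?thesis by (simp add: field_simps)
qed

text \<open>The index \<open>p\<close> is added by a Gram-Schmidt step: \<open>u\<close> is
  \<open>p\<close> minus the combination \<open>b\<close> of \<open>J\<close> with the same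
  covariances on \<open>J\<close>, so it has covariance 0 with \<open>J\<close> and, by coercivity,
  positive covariance with \<open>p\<close>. A multiple of \<open>u\<close> then corrects the old
  solution at \<open>p\<close> alone.\<close>

lemma kernel_solvable:
  assumes "finite J"
  shows "\<exists>a. \<forall>l\<in>J. cov J a l = t l"
  using assms
proof (induction J arbitrary: t rule: finite_induct)
  case (insert p J)
  obtain a where a: "\<And>l. l \<in> J \<Longrightarrow> cov J a l = t l" using insert.IH by blast
  obtain b where b: "\<And>l. l \<in> J \<Longrightarrow> cov J b l = \<rho> p l" using insert.IH by blast
  define u where "u = (\<lambda>j. if j = p then 1 else - b j)"
  define a' where "a' = (\<lambda>j. if j = p then 0 else a j)"
  have cong: "(\<Sum>i\<in>J. u i * \<rho> i l) = - cov J b l" "(\<Sum>i\<in>J. a' i * \<rho> i l) = cov J a l" for l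
    unfolding cov_def sum_negf[symmetric] using insert.hyps
    by (auto simp: u_def a'_def intro!: sum.cong)
  have cu: "cov (insert p J) u l = \<rho> p l - cov J b l"
    and ca: "cov (insert p J) a' l = cov J a l" for l
    using insert.hyps cong by (simp_all add: cov_def[of "insert p J"]) (simp_all add: u_def a'_def)
  have "form (insert p J) u u = u p * cov (insert p J) u p + (\<Sum>j\<in>J. u j * cov (insert p J) u j)"
    unfolding form_cov using insert.hyps by simp
  also have "(\<Sum>j\<in>J. u j * cov (insert p J) u j) = 0"
    by (intro sum.neutral ballI) (simp add: cu b)
  also have "u p * cov (insert p J) u p + 0 = cov (insert p J) u p"
    by (simp add: u_def)
  finally have "form (insert p J) u u = cov (insert p J) u p" .
  moreover have "\<kappa> * (\<Sum>i\<in>insert p J. (u i)\<^sup>2) > 0"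
    using insert.hyps kappa_pos
    by (intro mult_pos_pos sum_pos2[of _ p]) (auto simp: u_def)
  ultimately have up: "cov (insert p J) u p > 0"
    using form_ge[of "insert p J" u] insert.hyps by simp
  define s where "s = (t p - cov J a p) / cov (insert p J) u p"
  have "cov (insert p J) (\<lambda>j. a' j + s * u j) l = cov J a l + s * cov (insert p J) u l" for l
    unfolding ca[symmetric] by (simp add: cov_def sum.distrib sum_distrib_left algebra_simps)
  then have "\<forall>l\<in>insert p J. cov (insert p J) (\<lambda>j. a' j + s * u j) l = t l"
    using a b up by (auto simp: cu s_def)
  then show ?case by blast
qed simp

text \<open>Coefficients of the error in the best linear prediction of \<open>k\<close> from
  \<open>J\<close>: the normal equations make the error uncorrelated with every predictor. Vanishing
  off \<open>insert k J\<close> lets the sums run over any larger finite set.\<close>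

definition is_innovation :: "'i set \<Rightarrow> 'i \<Rightarrow> ('i \<Rightarrow> real) \<Rightarrow> bool" where
  "is_innovation J k e \<longleftrightarrow> e k = 1 \<and> (\<forall>i. i \<notin> insert k J \<longrightarrow> e i = 0) \<and>
     (\<forall>l\<in>J. cov (insert k J) e l = 0)"

lemma is_innovation_exists:
  assumes "finite J" "k \<notin> J"
  shows "\<exists>e. is_innovation J k e"
proof -
  obtain a where a: "\<And>l. l \<in> J \<Longrightarrow> cov J a l = \<rho> k l" using kernel_solvable[OF assms(1)] by metis
  define e where "e = (\<lambda>j. if j = k then 1 else if j \<in> J then - a j else 0)"
  have "(\<Sum>i\<in>J. e i * \<rho> i l) = - cov J a l" for l
    unfolding cov_def sum_negf[symmetric] using assms by (auto simp: e_def intro!: sum.cong)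
  then have "cov (insert k J) e l = \<rho> k l - cov J a l" for l
    using assms by (simp add: cov_def[of "insert k J"]) (simp add: e_def)
  then have "is_innovation J k e"
    using a by (auto simp: is_innovation_def e_def)
  then show ?thesis by blast
qed

definition innov :: "'i set \<Rightarrow> 'i \<Rightarrow> 'i \<Rightarrow> real" where
  "innov J k = (SOME e. is_innovation J k e)"

lemma is_innovation_innov: "finite J \<Longrightarrow> k \<notin> J \<Longrightarrow> is_innovation J k (innov J k)"
  unfolding innov_def by (rule someI_ex[of "is_innovation J k"]) (rule is_innovation_exists)

lemma innovation_orthogonal:
  assumes "is_innovation J k e" "finite S" "insert k J \<subseteq> S" "\<And>i. i \<in> S - J \<Longrightarrow> d i = 0"
  shows "form S e d = 0"
proof -
  have "cov S e l = cov (insert k J) e l" for l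
    using assms by (intro cov_mono_neutral) (auto simp: is_innovation_def)
  then have "d j * cov S e j = 0" if "j \<in> S" for j
    using assms that by (cases "j \<in> J") (auto simp: is_innovation_def)
  then show ?thesis unfolding form_cov by (simp add: sum.neutral)
qed

definition pvar :: "'i set \<Rightarrow> 'i \<Rightarrow> real" where
  "pvar J k = form (insert k J) (innov J k) (innov J k)"

text \<open>Two innovations for the same \<open>J\<close> and \<open>k\<close> both have coefficient
  1 at \<open>k\<close>, so their difference lives on \<open>J\<close> and is orthogonal to both.
  Hence the variance depends neither on the choice made in \<open>innov\<close> nor on the ambient
  set \<open>S\<close>.\<close>

lemma innovation_pvar:
  assumes "is_innovation J k e" "finite S" "insert k J \<subseteq> S" "k \<notin> J"
  shows "form S e e = pvar J k"
proof -
  have fJ: "finite J" using assms(2,3) finite_subset[of J S] by simp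
  let ?i = "innov J k"
  note I = is_innovation_innov[OF fJ assms(4)]
  have d: "e i - ?i i = 0" if "i \<in> S - J" for i
    using I assms(1) that by (cases "i = k") (auto simp: is_innovation_def)
  have "form S e e = form S e ?i"
    using innovation_orthogonal[OF assms(1-3), of "\<lambda>i. e i - ?i i", OF d] by (simp add: form_diff_right)
  also have "\<dots> = form S ?i ?i"
    using innovation_orthogonal[OF I assms(2-3), of "\<lambda>i. e i - ?i i", OF d]
    by (simp add: form_diff_right form_commute[of S e ?i])
  also have "\<dots> = pvar J k" unfolding pvar_def
    using assms I by (intro form_mono_neutral) (auto simp: is_innovation_def)
  finally show ?thesis .
qed

text \<open>The entry 1 at \<open>k\<close> alone contributes \<kappa> to the coercive lower
  bound.\<close>

lemma pvar_ge:
  assumes "finite J" "k \<notin> J"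
  shows "\<kappa> \<le> pvar J k"
proof -
  let ?e = "innov J k"
  have "\<kappa> * 1 \<le> \<kappa> * (\<Sum>i\<in>insert k J. (?e i)\<^sup>2)"
  proof (intro mult_left_mono)
    have "?e k = 1" using is_innovation_innov[OF assms] by (simp add: is_innovation_def)
    then show "1 \<le> (\<Sum>i\<in>insert k J. (?e i)\<^sup>2)"
      using assms by (simp add: sum_nonneg)
  qed (use kappa_pos in simp)
  then show ?thesis using form_ge[of "insert k J" ?e] assms by (simp add: pvar_def)
qed

text \<open>By Pythagoras the gap is the variance of the difference \<open>d\<close> of the two
  innovations, since \<open>d\<close> is supported on \<open>J \<union> K\<close> and hence
  orthogonal to the second one. The first one is orthogonal to \<open>K\<close>, so only its
  covariances with \<open>J\<close> survive, and \<open>form_le_dual\<close> applies.\<close>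

lemma pvar_gap:
  assumes "finite J" "finite K" "k \<notin> J \<union> K"
  shows "pvar K k - pvar (J \<union> K) k \<in> {0 .. (\<Sum>j\<in>J. (cov (insert k K) (innov K k) j)\<^sup>2) / \<kappa>}"
proof -
  define S where "S = insert k (J \<union> K)"
  let ?e = "innov K k" and ?f = "innov (J \<union> K) k"
  define d where "d = (\<lambda>i. ?e i - ?f i)"
  have fin: "finite S" using assms by (simp add: S_def)
  have I: "is_innovation K k ?e" "is_innovation (J \<union> K) k ?f"
    using assms by (auto intro!: is_innovation_innov)
  have d0: "d i = 0" if "i \<in> S - (J \<union> K)" for i
    using that I by (auto simp: d_def S_def is_innovation_def)
  have fd: "form S ?f d = 0"
    using I(2) fin d0 by (intro innovation_orthogonal[of "J \<union> K" k]) (auto simp: S_def)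
  have eq: "form S ?e ?e = form S ?f ?f + form S d d"
    using fd by (simp add: d_def form_diff_left form_diff_right form_commute[of S ?e ?f])
  then have gap: "pvar K k - pvar (J \<union> K) k = form S d d"
  proof -
    have "insert k K \<subseteq> S" "insert k (J \<union> K) \<subseteq> S" by (auto simp: S_def)
    then show ?thesis
      using innovation_pvar[OF I(1) fin] innovation_pvar[OF I(2) fin] assms(3) eq by simp
  qed
  have ce: "cov S ?e l = cov (insert k K) ?e l" for l
    using fin I(1) by (intro cov_mono_neutral) (auto simp: S_def is_innovation_def)
  have "form S d d = form S ?e d"
    using fd by (simp add: d_def form_diff_left)
  also have "\<dots> = (\<Sum>j\<in>S. d j * cov (insert k K) ?e j)"
    by (simp add: form_cov ce)
  also have "\<dots> = (\<Sum>j\<in>J. d j * cov (insert k K) ?e j)"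
    using fin d0 I(1) by (intro sum.mono_neutral_right) (auto simp: S_def is_innovation_def)
  finally have "form S d d = (\<Sum>j\<in>J. d j * cov (insert k K) ?e j)" .
  then have "form S d d \<le> (\<Sum>j\<in>J. (cov (insert k K) ?e j)\<^sup>2) / \<kappa>"
    by (intro form_le_dual[OF fin]) (auto simp: S_def)
  moreover have "0 \<le> form S d d"
    using form_ge[OF fin, of d] kappa_pos by (smt (verit) mult_nonneg_nonneg sum_nonneg zero_le_power2)
  ultimately show ?thesis by (simp add: gap)
qed

lemma pvar_empty: "pvar {} k = \<rho> k k"
  using is_innovation_innov[of "{}" k] by (simp add: pvar_def form_def is_innovation_def)

lemma pvar_le:
  assumes "finite J" "k \<notin> J"
  shows "pvar J k \<le> \<rho> k k"
  using pvar_gap[of J "{}" k] assms by (simp add: pvar_empty)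

end

section \<open>Consecutive windows of natural numbers\<close>

context
  fixes \<rho> :: "nat \<Rightarrow> nat \<Rightarrow> real" and \<kappa> :: real
  assumes ck: "coercive_kernel \<rho> \<kappa>"
begin

interpretation coercive_kernel \<rho> \<kappa> by (rule ck)

text \<open>The innovations within the block form an orthogonal family, and \<open>w\<close> is the
  projection of the variable \<open>j\<close> onto the block. Its variance is the Bessel sum on the
  left; being also the covariance of \<open>w\<close> with \<open>j\<close>, it is bounded through
  \<open>form_le_dual\<close>.\<close>

lemma innovation_bessel:
  "(\<Sum>k\<in>{a<..b}. (cov {a<..k} (innov {a<..<k} k) j)\<^sup>2 / pvar {a<..<k} k)
     \<le> (\<Sum>k\<in>{a<..b}. (\<rho> j k)\<^sup>2) / \<kappa>"
proof -
  define S where "S = {a<..b}"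
  have fin: "finite S" by (simp add: S_def)
  define e where "e = (\<lambda>k. innov {a<..<k} k)"
  define s where "s = (\<lambda>k. pvar {a<..<k} k)"
  define g where "g = (\<lambda>k. cov S (e k) j)"
  have s_pos: "s k > 0" for k
    using pvar_ge[of "{a<..<k}" k] kappa_pos by (simp add: s_def)
  have I: "is_innovation {a<..<k} k (e k)" for k
    unfolding e_def by (intro is_innovation_innov) auto
  have sub: "insert k {a<..<k} \<subseteq> S" if "k \<in> S" for k using that by (auto simp: S_def)
  \<comment> \<open>For \<open>l < k\<close> the support of \<open>e l\<close> lies among the
    predictors of \<open>k\<close>.\<close>
  have orth: "form S (e k) (e l) = 0" if "k \<in> S" "l \<in> S" "l < k" for k l
  proof (rule innovation_orthogonal[OF I fin sub[OF that(1)]])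
    fix i assume "i \<in> S - {a<..<k}"
    then have "i \<notin> insert l {a<..<l}" using that by (auto simp: S_def)
    then show "e l i = 0" using I[of l] unfolding is_innovation_def by blast
  qed
  have ortho: "form S (e k) (e l) = (if k = l then s k else 0)" if "k \<in> S" "l \<in> S" for k l
  proof (cases k l rule: linorder_cases)
    case less then show ?thesis using orth[OF that(2,1)] by (simp add: form_commute)
  next
    case equal then show ?thesis
      using innovation_pvar[OF I fin sub[OF that(1)]] that by (simp add: s_def)
  qed (use orth that in auto)
  \<comment> \<open>The Fourier expansion of the variable \<open>j\<close> in the orthogonal family
    \<open>e\<close>.\<close>
  define w where "w = (\<lambda>i. \<Sum>k\<in>S. g k / s k * e k i)"
  have "form S w (e l) = g l" if "l \<in> S" for l
  proof -
    have "form S w (e l) = (\<Sum>k\<in>S. if k = l then g l else 0)"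
      unfolding w_def form_sum_left using that s_pos[of l]
      by (intro sum.cong refl) (simp add: ortho)
    then show ?thesis using that fin by simp
  qed
  then have "form S (e l) w = g l" if "l \<in> S" for l
    using that form_commute by metis
  then have "form S w w = (\<Sum>k\<in>S. g k / s k * g k)"
    by (subst (1) w_def, subst form_sum_left) simp
  moreover have "cov S w j = (\<Sum>k\<in>S. g k / s k * g k)"
    unfolding w_def g_def cov_def sum_distrib_right sum_distrib_left
    by (subst sum.swap) (simp add: mult_ac)
  ultimately have "form S w w = (\<Sum>k\<in>S. (g k)\<^sup>2 / s k)"
    and "form S w w = (\<Sum>i\<in>S. w i * \<rho> j i)"
    by (simp_all add: power2_eq_square cov_def sym)
  then have le: "(\<Sum>k\<in>S. (g k)\<^sup>2 / s k) \<le> (\<Sum>k\<in>S. (\<rho> j k)\<^sup>2) / \<kappa>"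
    using form_le_dual[OF fin subset_refl] by metis
  have "g k = cov {a<..k} (e k) j" if "k \<in> S" for k
    unfolding g_def using I[of k] that
    by (intro cov_mono_neutral) (auto simp: S_def is_innovation_def)
  then have "(\<Sum>k\<in>S. (g k)\<^sup>2 / s k) = (\<Sum>k\<in>S. (cov {a<..k} (e k) j)\<^sup>2 / s k)" by simp
  with le show ?thesis by (simp add: S_def e_def s_def)
qed

text \<open>Each gain is controlled by the covariances of a second-block innovation with the first
  block. The factor \<open>R / pvar {a<..<k} k\<close>, at least 1, supplies the denominators of
  Bessel's inequality, which is then applied for each \<open>j\<close> of the first block.\<close>

lemma sum_pvar_gap_le:
  assumes R: "\<And>k. \<rho> k k \<le> R"
  shows "(\<Sum>k\<in>{a<..b}. pvar {a<..<k} k - pvar {0<..<k} k)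
           \<le> R / \<kappa>\<^sup>2 * (\<Sum>j\<in>{0<..a}. \<Sum>k\<in>{a<..b}. (\<rho> j k)\<^sup>2)"
proof -
  let ?g = "\<lambda>k j. cov {a<..k} (innov {a<..<k} k) j"
  let ?s = "\<lambda>k. pvar {a<..<k} k"
  have s: "0 < ?s k" "?s k \<le> R" for k
    using pvar_ge[of "{a<..<k}" k] pvar_le[of "{a<..<k}" k] R[of k] kappa_pos by auto
  have R0: "0 < R" using s[of 0] by simp
  have "?s k - pvar {0<..<k} k \<le> (\<Sum>j\<in>{0<..a}. R / \<kappa> * ((?g k j)\<^sup>2 / ?s k))" if "k \<in> {a<..b}" for k
  proof -
    have eq: "{0<..a} \<union> {a<..<k} = {0<..<k}" "insert k {a<..<k} = {a<..k}" using that by auto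
    have "?s k - pvar {0<..<k} k \<le> (\<Sum>j\<in>{0<..a}. (?g k j)\<^sup>2) / \<kappa>"
      using pvar_gap[of "{0<..a}" "{a<..<k}" k] that by (auto simp: eq)
    also have "\<dots> = (\<Sum>j\<in>{0<..a}. (?g k j)\<^sup>2 / \<kappa>)" by (simp add: sum_divide_distrib)
    also have "\<dots> \<le> (\<Sum>j\<in>{0<..a}. R / \<kappa> * ((?g k j)\<^sup>2 / ?s k))"
    proof (rule sum_mono)
      fix j
      have "(?g k j)\<^sup>2 * 1 \<le> (?g k j)\<^sup>2 * (R / ?s k)"
        using s[of k] by (intro mult_left_mono) (auto simp: le_divide_eq)
      then show "(?g k j)\<^sup>2 / \<kappa> \<le> R / \<kappa> * ((?g k j)\<^sup>2 / ?s k)"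
        using kappa_pos divide_right_mono[of "(?g k j)\<^sup>2" "(?g k j)\<^sup>2 * (R / ?s k)" \<kappa>]
        by (simp add: mult_ac)
    qed
    finally show ?thesis .
  qed
  then have "(\<Sum>k\<in>{a<..b}. ?s k - pvar {0<..<k} k)
      \<le> (\<Sum>k\<in>{a<..b}. \<Sum>j\<in>{0<..a}. R / \<kappa> * ((?g k j)\<^sup>2 / ?s k))"
    by (intro sum_mono)
  also have "\<dots> = R / \<kappa> * (\<Sum>j\<in>{0<..a}. \<Sum>k\<in>{a<..b}. (?g k j)\<^sup>2 / ?s k)"
    by (subst sum.swap) (simp add: sum_distrib_left)
  also have "\<dots> \<le> R / \<kappa> * (\<Sum>j\<in>{0<..a}. (\<Sum>k\<in>{a<..b}. (\<rho> j k)\<^sup>2) / \<kappa>)"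
    using innovation_bessel R0 kappa_pos by (intro mult_left_mono sum_mono) auto
  also have "\<dots> = R / \<kappa>\<^sup>2 * (\<Sum>j\<in>{0<..a}. \<Sum>k\<in>{a<..b}. (\<rho> j k)\<^sup>2)"
    by (simp add: sum_divide_distrib[symmetric] power2_eq_square)
  finally show ?thesis .
qed

text \<open>The innovation translated by \<open>m\<close> satisfies the normal equations of the
  translated window, and by \<open>innovation_pvar\<close> any innovation computes the prediction
  variance there.\<close>

lemma pvar_shift:
  assumes inv: "\<And>i j. \<rho> (i + m) (j + m) = \<rho> i j"
  shows "pvar {m<..<k + m} (k + m) = pvar {0<..<k} k"
proof (cases "k = 0")
  case True
  then show ?thesis using inv[of 0 0] by (simp add: pvar_empty)
next
  case False
  then have im: "insert (k + m) {m<..<k + m} = (\<lambda>i. i + m) ` insert k {0<..<k}"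
  proof (intro set_eqI iffI)
    fix x assume "x \<in> insert (k + m) {m<..<k + m}"
    then have "x = (x - m) + m" "x - m \<in> insert k {0<..<k}" by auto
    then show "x \<in> (\<lambda>i. i + m) ` insert k {0<..<k}" by (rule image_eqI)
  qed auto
  define e where "e = (\<lambda>i. if i < m then 0 else innov {0<..<k} k (i - m))"
  have sh: "e (i + m) = innov {0<..<k} k i" for i by (simp add: e_def)
  have inj: "inj_on (\<lambda>i. i + m) A" for A :: "nat set" by simp
  have I: "is_innovation {0<..<k} k (innov {0<..<k} k)"
    by (intro is_innovation_innov) auto
  have cov: "cov (insert (k + m) {m<..<k + m}) e (l + m) = cov (insert k {0<..<k}) (innov {0<..<k} k) l" for l
    unfolding im cov_def by (subst sum.reindex[OF inj]) (simp add: sh inv)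
  have "is_innovation {m<..<k + m} (k + m) e"
    unfolding is_innovation_def
  proof (intro conjI allI impI ballI)
    show "e (k + m) = 1" using I by (simp add: sh is_innovation_def)
    show "e i = 0" if "i \<notin> insert (k + m) {m<..<k + m}" for i
    proof (cases "i < m")
      case False
      then have "i - m \<notin> insert k {0<..<k}" using that \<open>k \<noteq> 0\<close> by auto
      then have "innov {0<..<k} k (i - m) = 0" using I unfolding is_innovation_def by blast
      then show ?thesis by (simp add: e_def)
    qed (simp add: e_def)
    show "cov (insert (k + m) {m<..<k + m}) e l = 0" if "l \<in> {m<..<k + m}" for l
      using cov[of "l - m"] I that by (auto simp: is_innovation_def)
  qed
  then have "pvar {m<..<k + m} (k + m) = form (insert (k + m) {m<..<k + m}) e e"
    by (intro innovation_pvar[symmetric]) auto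
  also have "\<dots> = pvar {0<..<k} k"
    unfolding im form_def pvar_def
    by (simp add: sum.reindex[OF inj] sh inv del: insert_iff image_insert)
  finally show ?thesis .
qed

end

section \<open>Uniqueness of multivariate characteristic functions\<close>

lemma (in finite_measure) integrable_mult_bounded:
  fixes w h :: "'a \<Rightarrow> real"
  assumes "w \<in> borel_measurable M" "h \<in> borel_measurable M"
    and w: "\<And>x. \<bar>w x\<bar> \<le> K" and h: "\<And>x. \<bar>h x\<bar> \<le> L"
  shows "integrable M (\<lambda>x. w x * h x)"
proof (rule integrable_const_bound[where B="K * L"])
  have "\<bar>w x\<bar> * \<bar>h x\<bar> \<le> K * L" for x
    using w[of x] h[of x] by (intro mult_mono) auto
  then show "AE x in M. norm (w x * h x) \<le> K * L"
    by (simp add: abs_mult)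
qed (use assms in simp)

text \<open>If the common mass is positive, the weighted laws of \<open>f\<close> and
  \<open>g\<close> become probability measures on the line after normalisation. The cosine and sine
  hypotheses are the real and imaginary parts of their characteristic functions, so Levy's
  uniqueness theorem identifies them.\<close>

lemma weighted_law_eq:
  fixes f :: "'a \<Rightarrow> real" and g :: "'b \<Rightarrow> real" and w :: "'a \<Rightarrow> real" and v :: "'b \<Rightarrow> real"
  assumes M: "finite_measure M" and N: "finite_measure N"
    and [measurable]: "f \<in> borel_measurable M" "g \<in> borel_measurable N"
      "w \<in> borel_measurable M" "v \<in> borel_measurable N" "B \<in> sets borel"
    and w: "\<And>x. 0 \<le> w x" "\<And>x. w x \<le> K" and v: "\<And>x. 0 \<le> v x" "\<And>x. v x \<le> K"
    and cos: "\<And>s. (\<integral>x. w x * cos (s * f x) \<partial>M) = (\<integral>x. v x * cos (s * g x) \<partial>N)"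
    and sin: "\<And>s. (\<integral>x. w x * sin (s * f x) \<partial>M) = (\<integral>x. v x * sin (s * g x) \<partial>N)"
  shows "(\<integral>x. w x * indicator B (f x) \<partial>M) = (\<integral>x. v x * indicator B (g x) \<partial>N)"
proof -
  interpret M: finite_measure M by fact
  interpret N: finite_measure N by fact
  have iM: "integrable M (\<lambda>x. w x * h x)" if "h \<in> borel_measurable M" "\<And>x. \<bar>h x\<bar> \<le> 1" for h
    using that w by (intro M.integrable_mult_bounded[where K=K and L=1]) auto
  have iN: "integrable N (\<lambda>x. v x * h x)" if "h \<in> borel_measurable N" "\<And>x. \<bar>h x\<bar> \<le> 1" for h
    using that v by (intro N.integrable_mult_bounded[where K=K and L=1]) auto
  note wi = iM[of "\<lambda>_. 1", simplified] and vi = iN[of "\<lambda>_. 1", simplified]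
  define c where "c = (\<integral>x. w x \<partial>M)"
  \<comment> \<open>Frequency 0 shows that both weights have the same total mass.\<close>
  have c': "c = (\<integral>x. v x \<partial>N)" using cos[of 0] by (simp add: c_def)
  have c0: "0 \<le> c" using w by (simp add: c_def)
  show ?thesis
  proof (cases "c = 0")
    \<comment> \<open>Mass 0 cannot be normalised; here both weights vanish almost
      everywhere.\<close>
    case True
    have "AE x in M. w x = 0"
      using integral_nonneg_eq_0_iff_AE[OF wi] True w by (simp add: c_def)
    then have "(\<integral>x. w x * indicator B (f x) \<partial>M) = (\<integral>x. 0 \<partial>M)"
      by (intro integral_cong_AE) auto
    moreover have "AE x in N. v x = 0"
      using integral_nonneg_eq_0_iff_AE[OF vi] True v by (simp add: c')
    then have "(\<integral>x. v x * indicator B (g x) \<partial>N) = (\<integral>x. 0 \<partial>N)"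
      by (intro integral_cong_AE) auto
    ultimately show ?thesis by simp
  next
    case False
    then have c: "0 < c" using c0 by simp
    define M' where "M' = distr (density M (\<lambda>x. ennreal (w x / c))) borel f"
    define N' where "N' = distr (density N (\<lambda>x. ennreal (v x / c))) borel g"
    have "prob_space (density M (\<lambda>x. ennreal (w x / c)))"
      using c w wi by (intro prob_spaceI)
        (simp add: emeasure_density nn_integral_eq_integral c_def[symmetric])
    then have M': "real_distribution M'"
      unfolding M'_def by (intro prob_space.real_distribution_distr) auto
    have "prob_space (density N (\<lambda>x. ennreal (v x / c)))"
      using c v vi by (intro prob_spaceI)
        (simp add: emeasure_density nn_integral_eq_integral c'[symmetric])
    then have N': "real_distribution N'"
      unfolding N'_def by (intro prob_space.real_distribution_distr) auto
    have cM: "char M' t = (\<integral>x. (w x / c) *\<^sub>R iexp (t * f x) \<partial>M)" for t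
      unfolding char_def M'_def using c w
      by (subst integral_distr) (auto simp: integral_density)
    have cN: "char N' t = (\<integral>x. (v x / c) *\<^sub>R iexp (t * g x) \<partial>N)" for t
      unfolding char_def N'_def using c v
      by (subst integral_distr) (auto simp: integral_density)
    have bM: "integrable M (\<lambda>x. (w x / c) *\<^sub>R iexp (t * f x))" for t
      using w c by (intro M.integrable_const_bound[where B="K / c"])
        (auto simp: divide_right_mono intro!: AE_I2)
    have bN: "integrable N (\<lambda>x. (v x / c) *\<^sub>R iexp (t * g x))" for t
      using v c by (intro N.integrable_const_bound[where B="K / c"])
        (auto simp: divide_right_mono intro!: AE_I2)
    have "char M' t = char N' t" for t
    proof (rule complex_eqI)
      show "Re (char M' t) = Re (char N' t)"
        unfolding cM cN integral_Re[OF bM, symmetric] integral_Re[OF bN, symmetric]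
        using cos[of t] by (simp add: Re_exp)
      show "Im (char M' t) = Im (char N' t)"
        unfolding cM cN integral_Im[OF bM, symmetric] integral_Im[OF bN, symmetric]
        using sin[of t] by (simp add: Im_exp)
    qed
    then have eq: "M' = N'" using Levy_uniqueness[OF M' N'] by blast
    have "(\<integral>x. w x * indicator B (f x) \<partial>M) / c = (\<integral>x. indicator B x \<partial>M')"
      unfolding M'_def using c w
      by (subst integral_distr) (auto simp: integral_density simp flip: integral_divide_zero)
    also have "\<dots> = (\<integral>x. v x * indicator B (g x) \<partial>N) / c"
      unfolding eq N'_def using c v
      by (subst integral_distr) (auto simp: integral_density simp flip: integral_divide_zero)
    finally show ?thesis using c by simp
  qed
qed

text \<open>The factors \<open>exp (i t\<^sub>i x\<^sub>i)\<close> are exchanged for indicators of Borel sets one coordinate at a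
  time, by the one-dimensional uniqueness theorem for measures weighted with the nonnegative
  function \<open>1 + cos \<theta>\<close>, where \<open>\<theta>\<close> depends on the remaining coordinates.\<close>

theorem char_PiM_unique:
  fixes \<mu> \<nu> :: "('i \<Rightarrow> real) measure"
  assumes I: "finite I" and \<mu>: "finite_measure \<mu>" and \<nu>: "finite_measure \<nu>"
    and s\<mu>: "sets \<mu> = sets (PiM I (\<lambda>_. borel))" and s\<nu>: "sets \<nu> = sets (PiM I (\<lambda>_. borel))"
    and char: "\<And>t. (CLINT x|\<mu>. iexp (\<Sum>i\<in>I. t i * x i)) = (CLINT x|\<nu>. iexp (\<Sum>i\<in>I. t i * x i))"
  shows "\<mu> = \<nu>"
proof -
  interpret \<mu>: finite_measure \<mu> by fact
  interpret \<nu>: finite_measure \<nu> by fact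
  have m\<mu>: "(\<lambda>x. x i) \<in> borel_measurable \<mu>" if "i \<in> I" for i
    using that by (simp add: measurable_cong_sets[OF s\<mu> refl])
  have m\<nu>: "(\<lambda>x. x i) \<in> borel_measurable \<nu>" if "i \<in> I" for i
    using that by (simp add: measurable_cong_sets[OF s\<nu> refl])
  \<comment> \<open>Coordinates in \<open>A\<close> have already been exchanged for indicators;
    those in \<open>I - A\<close> still enter through the phase.\<close>
  define w :: "'i set \<Rightarrow> ('i \<Rightarrow> real set) \<Rightarrow> ('i \<Rightarrow> real) \<Rightarrow> real"
    where "w = (\<lambda>A B x. \<Prod>i\<in>A. indicator (B i) (x i))"
  define \<theta> :: "'i set \<Rightarrow> ('i \<Rightarrow> real) \<Rightarrow> ('i \<Rightarrow> real) \<Rightarrow> real"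
    where "\<theta> = (\<lambda>A t x. \<Sum>i\<in>I - A. t i * x i)"
  have w01: "0 \<le> w A B x" "w A B x \<le> 1" for A B x
    by (auto simp: w_def intro!: prod_nonneg prod_le_1)
  have wm: "w A B \<in> borel_measurable \<mu>" "w A B \<in> borel_measurable \<nu>"
    if "A \<subseteq> I" "\<And>i. B i \<in> sets borel" for A B
    unfolding w_def using that m\<mu> m\<nu> by (auto intro!: borel_measurable_prod measurable_compose[OF _ borel_measurable_indicator])
  have \<theta>m: "\<theta> A t \<in> borel_measurable \<mu>" "\<theta> A t \<in> borel_measurable \<nu>" for A t
    unfolding \<theta>_def using m\<mu> m\<nu> by (auto intro!: borel_measurable_sum borel_measurable_times)
  have w_abs: "\<bar>w A B x\<bar> \<le> 1" for A B x using w01[of A B x] by simp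
  have int\<mu>: "integrable \<mu> (\<lambda>x. w A B x * h x)"
    if "A \<subseteq> I" "\<And>i. B i \<in> sets borel" "h \<in> borel_measurable \<mu>" "\<And>x. \<bar>h x\<bar> \<le> 2" for A B h
    using that w_abs by (intro \<mu>.integrable_mult_bounded[where K=1 and L=2] wm) auto
  have int\<nu>: "integrable \<nu> (\<lambda>x. w A B x * h x)"
    if "A \<subseteq> I" "\<And>i. B i \<in> sets borel" "h \<in> borel_measurable \<nu>" "\<And>x. \<bar>h x\<bar> \<le> 2" for A B h
    using that w_abs by (intro \<nu>.integrable_mult_bounded[where K=1 and L=2] wm) auto
  \<comment> \<open>Cosines suffice because the shift \<phi> is arbitrary: it also covers sines and
    the sign change used in \<open>split\<close>.\<close>
  have main: "(\<integral>x. w A B x * cos (\<phi> + \<theta> A t x) \<partial>\<mu>) = (\<integral>x. w A B x * cos (\<phi> + \<theta> A t x) \<partial>\<nu>)"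
    if "finite A" "A \<subseteq> I" "\<And>i. B i \<in> sets borel" for A B \<phi> t
    using that
  proof (induction A arbitrary: B \<phi> t rule: finite_induct)
    case empty
    have "cos (\<phi> + s) = Re (iexp \<phi> * iexp s)" for s
      by (simp add: Re_exp flip: exp_add distrib_left)
    moreover have "(\<integral>x. Re (iexp \<phi> * iexp (\<theta> {} t x)) \<partial>\<mu>) = (\<integral>x. Re (iexp \<phi> * iexp (\<theta> {} t x)) \<partial>\<nu>)"
    proof -
      have "integrable \<mu> (\<lambda>x. iexp (\<theta> {} t x))" "integrable \<nu> (\<lambda>x. iexp (\<theta> {} t x))"
        using \<theta>m[of "{}" t]
        by (auto intro!: AE_I2 \<mu>.integrable_const_bound[where B=1] \<nu>.integrable_const_bound[where B=1])
      then show ?thesis using char[of t]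
        by (subst (1 2) integral_Re) (auto simp: \<theta>_def)
    qed
    ultimately show ?case by (simp add: w_def)
  next
    case (insert p A)
    have A: "A \<subseteq> I" "p \<in> I" "p \<notin> A" using insert by auto
    note B = insert.prems(2)
    have IH: "(\<integral>x. w A B x * cos (a + \<theta> A u x) \<partial>\<mu>) = (\<integral>x. w A B x * cos (a + \<theta> A u x) \<partial>\<nu>)" for a u
      by (rule insert.IH[OF A(1) B])
    have \<theta>p: "\<theta> A (t(p := s)) x = s * x p + \<theta> (insert p A) t x" for s t x
    proof -
      have "\<theta> A (t(p := s)) x = s * x p + (\<Sum>i\<in>I - A - {p}. (t(p := s)) i * x i)"
        unfolding \<theta>_def using A I by (subst sum.remove[of "I - A" p]) auto
      also have "I - A - {p} = I - insert p A" by auto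
      also have "(\<Sum>i\<in>I - insert p A. (t(p := s)) i * x i) = \<theta> (insert p A) t x"
        unfolding \<theta>_def by (intro sum.cong) auto
      finally show ?thesis .
    qed
    have \<theta>neg: "\<theta> C (\<lambda>i. - t i) x = - \<theta> C t x" for C t x
      by (simp add: \<theta>_def sum_negf)
    note \<theta>m[of "insert p A" t, measurable] wm[OF A(1) B, measurable] m\<mu>[OF A(2), measurable] m\<nu>[OF A(2), measurable]
    \<comment> \<open>Product-to-sum formulas turn every term into a cosine handled by the induction
      hypothesis: the factor in \<open>x p\<close> becomes the frequency \<open>s\<close> at
      \<open>p\<close>, a coordinate still outside \<open>A\<close>.\<close>
    have osc: "(\<integral>x. w A B x * (1 + cos (\<psi> + \<theta> (insert p A) t x)) * cos (s * x p + \<eta>) \<partial>\<mu>)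
        = (\<integral>x. w A B x * (1 + cos (\<psi> + \<theta> (insert p A) t x)) * cos (s * x p + \<eta>) \<partial>\<nu>)"
      (is "?L \<mu> = ?L \<nu>") for \<psi> s \<eta>
    proof -
      let ?t0 = "(\<lambda>_. 0)(p := s)" and ?t1 = "t(p := s)" and ?t2 = "(\<lambda>i. - t i)(p := s)"
      have prod: "cos a * cos b = (cos (b + a) + cos (b - a)) / 2" for a b :: real
        by (simp add: cos_add cos_diff)
      have "w A B x * (1 + cos (\<psi> + \<theta> (insert p A) t x)) * cos (s * x p + \<eta>)
          = w A B x * cos (\<eta> + \<theta> A ?t0 x)
            + (w A B x * cos (\<eta> + \<psi> + \<theta> A ?t1 x) + w A B x * cos (\<eta> - \<psi> + \<theta> A ?t2 x)) / 2" for x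
      proof -
        let ?z = "\<theta> (insert p A) t x"
        have "\<eta> + \<theta> A ?t0 x = s * x p + \<eta>" "\<eta> + \<psi> + \<theta> A ?t1 x = (s * x p + \<eta>) + (\<psi> + ?z)"
          "\<eta> - \<psi> + \<theta> A ?t2 x = (s * x p + \<eta>) - (\<psi> + ?z)"
          unfolding \<theta>p \<theta>neg by (simp_all add: \<theta>_def)
        moreover have "u * (1 + a) * b = u * b + (u * c + u * d) / 2" if "a * b = (c + d) / 2"
          for u a b c d :: real
        proof -
          have "u * (1 + a) * b = u * b + u * (a * b)" by (simp add: algebra_simps)
          then show ?thesis by (simp add: that algebra_simps)
        qed
        ultimately show ?thesis using prod by presburger
      qed
      moreover have "integrable \<mu> (\<lambda>x. w A B x * cos (a + \<theta> A u x))"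
          "integrable \<nu> (\<lambda>x. w A B x * cos (a + \<theta> A u x))" for a u
      proof -
        have "\<bar>cos z\<bar> \<le> 2" for z :: real using abs_cos_le_one[of z] by linarith
        then show "integrable \<mu> (\<lambda>x. w A B x * cos (a + \<theta> A u x))"
            "integrable \<nu> (\<lambda>x. w A B x * cos (a + \<theta> A u x))"
          using \<theta>m[of A u] by (auto intro!: int\<mu>[OF A(1) B] int\<nu>[OF A(1) B])
      qed
      ultimately show ?thesis by (simp add: IH del: fun_upd_apply)
    qed
    have F: "(\<integral>x. w A B x * (1 + cos (\<psi> + \<theta> (insert p A) t x)) * indicator (B p) (x p) \<partial>\<mu>)
        = (\<integral>x. w A B x * (1 + cos (\<psi> + \<theta> (insert p A) t x)) * indicator (B p) (x p) \<partial>\<nu>)" for \<psi>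
    \<comment> \<open>The shifts 0 and \<open>- (pi / 2)\<close> in \<open>osc\<close> provide the
      cosine and sine hypotheses.\<close>
    proof (rule weighted_law_eq[OF \<mu> \<nu>, where K=2])
      have bd: "0 \<le> 1 + cos z" "1 + cos z \<le> 2" for z :: real
        using cos_ge_minus_one[of z] cos_le_one[of z] by linarith+
      have "w A B x * (1 + cos (\<psi> + \<theta> (insert p A) t x)) \<le> 1 * 2" for x
        using w01[of A B x] bd by (intro mult_mono) auto
      then show "w A B x * (1 + cos (\<psi> + \<theta> (insert p A) t x)) \<le> 2"
        "w A B x * (1 + cos (\<psi> + \<theta> (insert p A) t x)) \<le> 2" for x by simp_all
      show "0 \<le> w A B x * (1 + cos (\<psi> + \<theta> (insert p A) t x))"
        "0 \<le> w A B x * (1 + cos (\<psi> + \<theta> (insert p A) t x))" for x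
        using w01[of A B x] bd by simp_all
    qed (use osc[of _ _ 0] osc[of _ _ "- (pi / 2)"] B in \<open>auto simp: cos_diff\<close>)
    have w_ins: "w (insert p A) B x = w A B x * indicator (B p) (x p)" for x
      using A insert.hyps by (simp add: w_def mult.commute)
    \<comment> \<open>The constant part of the weight cancels between the phases \<phi> and
      \<open>\<phi> + pi\<close>, leaving twice the cosine.\<close>
    have split: "w (insert p A) B x * cos (\<phi> + \<theta> (insert p A) t x)
        = (w A B x * (1 + cos (\<phi> + \<theta> (insert p A) t x)) * indicator (B p) (x p)
           - w A B x * (1 + cos (\<phi> + pi + \<theta> (insert p A) t x)) * indicator (B p) (x p)) / 2" for x
    proof -
      have "cos (\<phi> + pi + z) = - cos (\<phi> + z)" for z :: real
        using cos_periodic_pi[of "\<phi> + z"] by (simp add: add_ac)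
      then show ?thesis by (simp add: w_ins algebra_simps)
    qed
    have i: "integrable \<mu> (\<lambda>x. w A B x * (1 + cos (\<psi> + \<theta> (insert p A) t x)) * indicator (B p) (x p))"
      "integrable \<nu> (\<lambda>x. w A B x * (1 + cos (\<psi> + \<theta> (insert p A) t x)) * indicator (B p) (x p))" for \<psi>
    proof -
      have "\<bar>1 + cos z\<bar> \<le> 2" for z :: real
        using cos_ge_minus_one[of z] cos_le_one[of z] by linarith
      then have "\<bar>(1 + cos z) * indicator (B p) y\<bar> \<le> 2" for z y :: real
        by (simp add: indicator_def)
      then show "integrable \<mu> (\<lambda>x. w A B x * (1 + cos (\<psi> + \<theta> (insert p A) t x)) * indicator (B p) (x p))"
      "integrable \<nu> (\<lambda>x. w A B x * (1 + cos (\<psi> + \<theta> (insert p A) t x)) * indicator (B p) (x p))"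
        unfolding mult.assoc using B by (auto intro!: int\<mu>[OF A(1) B] int\<nu>[OF A(1) B])
    qed
    show ?case unfolding split by (simp add: i F)
  qed
  show ?thesis
  proof (rule measure_eqI_PiM_finite[OF I s\<mu> s\<nu>])
    show "emeasure \<mu> (Pi\<^sub>E I B) = emeasure \<nu> (Pi\<^sub>E I B)" if "\<And>i. i \<in> I \<Longrightarrow> B i \<in> sets borel" for B
    proof -
      \<comment> \<open>Nothing is known about \<open>B\<close> outside \<open>I\<close>, while
        \<open>main\<close> asks for Borel sets at every index.\<close>
      define B' where "B' = (\<lambda>i. if i \<in> I then B i else {})"
      have E: "Pi\<^sub>E I B \<in> sets (PiM I (\<lambda>_. borel))"
        using that I by (intro sets_PiM_I_finite) auto
      have wI: "w I B' x = indicator (Pi\<^sub>E I B) x" if "x \<in> extensional I" for x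
        using that I by (auto simp: w_def B'_def indicator_def PiE_def Pi_def prod_zero_iff intro!: prod.neutral)
      have sp: "space \<mu> = extensional I" "space \<nu> = extensional I"
        using sets_eq_imp_space_eq[OF s\<mu>] sets_eq_imp_space_eq[OF s\<nu>] by (auto simp: space_PiM PiE_def)
      have "(\<integral>x. w I B' x \<partial>\<mu>) = (\<integral>x. indicator (Pi\<^sub>E I B) x \<partial>\<mu>)"
        by (intro Bochner_Integration.integral_cong) (simp_all add: wI sp)
      moreover have "(\<integral>x. w I B' x \<partial>\<nu>) = (\<integral>x. indicator (Pi\<^sub>E I B) x \<partial>\<nu>)"
        by (intro Bochner_Integration.integral_cong) (simp_all add: wI sp)
      ultimately have "(\<integral>x. w I B' x \<partial>\<mu>) = measure \<mu> (Pi\<^sub>E I B)" "(\<integral>x. w I B' x \<partial>\<nu>) = measure \<nu> (Pi\<^sub>E I B)"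
        by (simp_all add: sp PiE_def)
      moreover have "(\<integral>x. w I B' x \<partial>\<mu>) = (\<integral>x. w I B' x \<partial>\<nu>)"
        using main[of I B' 0 "\<lambda>_. 0"] that I by (simp add: B'_def \<theta>_def)
      ultimately show ?thesis by (simp add: \<mu>.emeasure_eq_measure \<nu>.emeasure_eq_measure)
    qed
    show "range (\<lambda>_::nat. space (PiM I (\<lambda>_. borel))) \<subseteq> prod_algebra I (\<lambda>_. borel)"
      using I by (auto intro!: prod_algebraI_finite simp: space_PiM)
    show "(\<Union>n. space (PiM I (\<lambda>_. borel))) = space (PiM I (\<lambda>_. borel))" by simp
    show "emeasure \<mu> (space (PiM I (\<lambda>_. borel))) \<noteq> \<infinity>"
      by (simp add: \<mu>.emeasure_finite)
  qed
qed

section \<open>Joint density and entropy of a Gaussian process\<close>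

text \<open>The substitution \<open>y = m + \<sigma> * x\<close> reduces the integral to the
  characteristic function of the standard normal distribution.\<close>

lemma char_normal_density:
  assumes \<sigma>: "0 < \<sigma>"
  shows "(CLINT y|lborel. normal_density m \<sigma> y *\<^sub>R iexp (t * y)) = iexp (t * m) * exp (- (t\<^sup>2 * \<sigma>\<^sup>2) / 2)"
proof -
  have dens: "\<sigma> * normal_density m \<sigma> (m + \<sigma> * x) = std_normal_density x" for x
    using \<sigma> by (simp add: normal_density_def real_sqrt_mult power_mult_distrib)
  have "(CLINT y|lborel. normal_density m \<sigma> y *\<^sub>R iexp (t * y))
      = \<bar>\<sigma>\<bar> *\<^sub>R (CLINT x|lborel. normal_density m \<sigma> (m + \<sigma> * x) *\<^sub>R iexp (t * (m + \<sigma> * x)))"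
    using \<sigma> by (intro lborel_integral_real_affine) simp
  also have "\<dots> = (CLINT x|lborel. \<bar>\<sigma>\<bar> *\<^sub>R (normal_density m \<sigma> (m + \<sigma> * x) *\<^sub>R iexp (t * (m + \<sigma> * x))))"
    by (simp only: integral_scaleR_right)
  also have "\<dots> = (CLINT x|lborel. iexp (t * m) * (std_normal_density x *\<^sub>R iexp (t * \<sigma> * x)))"
  proof (rule Bochner_Integration.integral_cong[OF refl])
    fix x
    have "iexp (t * (m + \<sigma> * x)) = iexp (t * m) * iexp (t * \<sigma> * x)"
      by (simp add: algebra_simps flip: exp_add)
    then show "\<bar>\<sigma>\<bar> *\<^sub>R (normal_density m \<sigma> (m + \<sigma> * x) *\<^sub>R iexp (t * (m + \<sigma> * x)))
        = iexp (t * m) * (std_normal_density x *\<^sub>R iexp (t * \<sigma> * x))"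
      using \<sigma> by (simp only: dens[symmetric]) simp
  qed
  also have "\<dots> = iexp (t * m) * char std_normal_distribution (t * \<sigma>)"
    unfolding char_def integral_mult_right_zero by (subst integral_density) auto
  finally show ?thesis
    by (simp add: char_std_normal_distribution power_mult_distrib flip: exp_of_real)
qed

lemma ln_normal_density:
  assumes "0 < v"
  shows "ln (normal_density m (sqrt v) x) = - ln (2 * pi * v) / 2 - (x - m)\<^sup>2 / (2 * v)"
  using assms by (simp add: normal_density_def ln_mult ln_div ln_sqrt field_simps)

section \<open>Gaussian variables, degenerate ones included\<close>

context prob_space
begin

text \<open>Normal moments are available centred at \<open>m\<close>, so the square of
  \<open>Y\<close> is expanded about \<open>m\<close>; in the degenerate case it is almost surely
  constant.\<close>

lemma gaussian_rv_integrable_square: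
  assumes "gaussian_rv M Y"
  shows "integrable M (\<lambda>\<omega>. (Y \<omega>)\<^sup>2)"
proof -
  have [measurable]: "Y \<in> borel_measurable M" using assms by (simp add: gaussian_rv_def)
  consider m \<sigma> where "0 < \<sigma>" "distributed M lborel Y (\<lambda>x. ennreal (normal_density m \<sigma> x))"
    | m where "AE \<omega> in M. Y \<omega> = m"
    using assms by (auto simp: gaussian_rv_def)
  then show ?thesis
  proof cases
    case 1
    have "integrable M (\<lambda>\<omega>. (Y \<omega> - m) ^ k)" for k
      using integrable_normal_moment[OF 1(1), of m k]
      by (subst distributed_integrable[OF 1(2), symmetric, where g="\<lambda>y. (y - m) ^ k"]) auto
    from this[of 1] this[of 2]
    have "integrable M (\<lambda>\<omega>. (Y \<omega> - m)\<^sup>2 + (2 * m * (Y \<omega> - m) ^ 1 + m\<^sup>2))"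
      by (intro Bochner_Integration.integrable_add integrable_mult_right) auto
    then show ?thesis by (simp add: power2_eq_square algebra_simps)
  next
    case 2
    then have "AE \<omega> in M. norm ((Y \<omega>)\<^sup>2) \<le> m\<^sup>2" by eventually_elim simp
    then show ?thesis by (intro integrable_const_bound) auto
  qed
qed

text \<open>A point mass obeys the same formula with variance 0, so the two kinds of Gaussian
  variable need not be separated afterwards.\<close>

lemma gaussian_rv_char:
  assumes "gaussian_rv M Y"
  shows "(CLINT \<omega>|M. iexp (Y \<omega>)) = iexp (expectation Y) * exp (- variance Y / 2)"
proof -
  have [measurable]: "Y \<in> borel_measurable M" using assms by (simp add: gaussian_rv_def)
  consider m \<sigma> where "0 < \<sigma>" "distributed M lborel Y (\<lambda>x. ennreal (normal_density m \<sigma> x))"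
    | m where "AE \<omega> in M. Y \<omega> = m"
    using assms by (auto simp: gaussian_rv_def)
  then show ?thesis
  proof cases
    case 1
    have "(CLINT \<omega>|M. iexp (Y \<omega>)) = (CLINT y|distr M lborel Y. iexp y)"
      by (subst integral_distr) auto
    also have "\<dots> = (CLINT y|lborel. normal_density m \<sigma> y *\<^sub>R iexp (1 * y))"
      unfolding distributed_distr_eq_density[OF 1(2)] by (subst integral_density) auto
    finally show ?thesis
      using char_normal_density[OF 1(1), of m 1] normal_distributed_expectation[OF 1]
        normal_distributed_variance[OF 1] by (simp flip: exp_of_real)
  next
    case 2
    have "(CLINT \<omega>|M. iexp (Y \<omega>)) = (CLINT \<omega>|M. iexp m)"
      using 2 by (intro integral_cong_AE) (auto elim: eventually_mono)
    moreover have m: "expectation Y = (\<integral>\<omega>. m \<partial>M)"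
      using 2 by (intro integral_cong_AE) auto
    moreover have "variance Y = (\<integral>\<omega>. 0 \<partial>M)"
      using 2 m by (intro integral_cong_AE) (auto elim: eventually_mono simp: prob_space)
    ultimately show ?thesis by (simp add: prob_space)
  qed
qed

lemma integrable_mult_square:
  fixes Y Z :: "'a \<Rightarrow> real"
  assumes [measurable]: "Y \<in> borel_measurable M" "Z \<in> borel_measurable M"
    and "integrable M (\<lambda>\<omega>. (Y \<omega>)\<^sup>2)" "integrable M (\<lambda>\<omega>. (Z \<omega>)\<^sup>2)"
  shows "integrable M (\<lambda>\<omega>. Y \<omega> * Z \<omega>)"
proof (rule Bochner_Integration.integrable_bound)
  show "integrable M (\<lambda>\<omega>. (Y \<omega>)\<^sup>2 + (Z \<omega>)\<^sup>2)" using assms by simp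
  have "\<bar>y * z\<bar> \<le> y\<^sup>2 + z\<^sup>2" for y z :: real
  proof -
    have "2 * (\<bar>y\<bar> * \<bar>z\<bar>) \<le> y\<^sup>2 + z\<^sup>2" "0 \<le> \<bar>y\<bar> * \<bar>z\<bar>"
      using sum_squares_bound[of "\<bar>y\<bar>" "\<bar>z\<bar>"] by simp_all
    then show ?thesis unfolding abs_mult by linarith
  qed
  then show "AE \<omega> in M. norm (Y \<omega> * Z \<omega>) \<le> norm ((Y \<omega>)\<^sup>2 + (Z \<omega>)\<^sup>2)" by simp
qed simp

end

section \<open>Finite blocks of a nondegenerate Gaussian process\<close>

locale nondegenerate_gaussian = prob_space M + coercive_kernel \<rho> \<kappa>
  for M :: "'a measure" and \<rho> :: "nat \<Rightarrow> nat \<Rightarrow> real" and \<kappa> +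
  fixes X :: "nat \<Rightarrow> 'a \<Rightarrow> real"
  assumes gaussian: "gaussian_process M X"
    and covariance: "1 \<le> i \<Longrightarrow> 1 \<le> j \<Longrightarrow>
      \<rho> i j = expectation (\<lambda>\<omega>. (X i \<omega> - expectation (X i)) * (X j \<omega> - expectation (X j)))"
begin

definition mean :: "nat \<Rightarrow> real" where "mean j = expectation (X j)"

lemma gaussian_rv_X: "1 \<le> j \<Longrightarrow> gaussian_rv M (X j)"
proof -
  assume "1 \<le> j"
  then have "gaussian_rv M (\<lambda>\<omega>. \<Sum>i\<in>{j}. 1 * X i \<omega>)"
    using gaussian unfolding gaussian_process_def by (elim allE[of _ "{j}"] allE[of _ "\<lambda>_. 1"]) auto
  then show ?thesis by simp
qed

lemma X_measurable: "1 \<le> j \<Longrightarrow> X j \<in> borel_measurable M"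
  using gaussian_rv_X by (auto simp: gaussian_rv_def)

lemma integrable_X: "1 \<le> j \<Longrightarrow> integrable M (X j)"
  using integrable_mult_square[of "X j" "\<lambda>_. 1"] gaussian_rv_integrable_square[OF gaussian_rv_X]
    X_measurable by simp

lemma integrable_centered_mult:
  assumes "1 \<le> i" "1 \<le> j"
  shows "integrable M (\<lambda>\<omega>. (X i \<omega> - mean i) * (X j \<omega> - mean j))"
proof -
  have "integrable M (\<lambda>\<omega>. X i \<omega> * X j \<omega>)"
    using assms gaussian_rv_integrable_square[OF gaussian_rv_X] X_measurable
    by (intro integrable_mult_square) auto
  then have "integrable M (\<lambda>\<omega>. X i \<omega> * X j \<omega> - mean i * X j \<omega> - mean j * X i \<omega> + mean i * mean j)"
    using integrable_X assms by simp
  then show ?thesis by (simp add: algebra_simps)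
qed

lemma expectation_square:
  assumes "finite J" "J \<subseteq> {1..}"
  shows "integrable M (\<lambda>\<omega>. (\<Sum>j\<in>J. c j * (X j \<omega> - mean j))\<^sup>2)"
    and "expectation (\<lambda>\<omega>. (\<Sum>j\<in>J. c j * (X j \<omega> - mean j))\<^sup>2) = form J c c"
proof -
  have J: "1 \<le> j" if "j \<in> J" for j using assms that by auto
  have eq: "(\<Sum>j\<in>J. c j * (X j \<omega> - mean j))\<^sup>2
      = (\<Sum>i\<in>J. \<Sum>j\<in>J. c i * c j * ((X i \<omega> - mean i) * (X j \<omega> - mean j)))" for \<omega>
    by (simp add: power2_eq_square sum_product mult_ac)
  show "integrable M (\<lambda>\<omega>. (\<Sum>j\<in>J. c j * (X j \<omega> - mean j))\<^sup>2)"
    unfolding eq using J integrable_centered_mult by auto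
  show "expectation (\<lambda>\<omega>. (\<Sum>j\<in>J. c j * (X j \<omega> - mean j))\<^sup>2) = form J c c"
    unfolding eq form_def using J integrable_centered_mult
    by (simp add: covariance mean_def)
qed

text \<open>The Gaussian hypothesis concerns linear combinations, so the joint characteristic
  function is that of a single Gaussian variable at frequency 1.\<close>

lemma char_linear_combination:
  assumes "finite J" "J \<subseteq> {1..}"
  shows "(CLINT \<omega>|M. iexp (\<Sum>j\<in>J. c j * X j \<omega>)) = iexp (\<Sum>j\<in>J. c j * mean j) * exp (- form J c c / 2)"
proof -
  let ?Y = "\<lambda>\<omega>. \<Sum>j\<in>J. c j * X j \<omega>"
  have "1 \<le> j" if "j \<in> J" for j using assms that by auto
  then have E: "expectation ?Y = (\<Sum>j\<in>J. c j * mean j)"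
    using integrable_X by (simp add: mean_def)
  have "variance ?Y = form J c c"
    unfolding E expectation_square(2)[OF assms, symmetric]
    by (simp add: right_diff_distrib sum_subtractf)
  moreover have "gaussian_rv M ?Y" using gaussian assms by (auto simp: gaussian_process_def)
  ultimately show ?thesis using gaussian_rv_char[of ?Y] E by simp
qed

text \<open>Best affine prediction of coordinate \<open>k\<close> from the earlier ones. The sum is
  subtracted because \<open>innov\<close> carries the regression coefficients with the opposite
  sign.\<close>

definition predictor :: "nat \<Rightarrow> (nat \<Rightarrow> real) \<Rightarrow> real" where
  "predictor k x = mean k - (\<Sum>j\<in>{0<..<k}. innov {0<..<k} k j * (x j - mean j))"

text \<open>The chain-rule form of the Gaussian density, one conditional normal density per
  coordinate; no determinant or inverse of the covariance matrix appears. Coercivity keeps every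
  conditional variance positive.\<close>

definition joint_density :: "nat \<Rightarrow> (nat \<Rightarrow> real) \<Rightarrow> real" where
  "joint_density n x = (\<Prod>k\<in>{1..n}. normal_density (predictor k x) (sqrt (pvar {0<..<k} k)) (x k))"

lemma pvar_pos: "0 < pvar {0<..<k} k"
  using pvar_ge[of "{0<..<k}" k] kappa_pos by simp

lemma joint_density_pos: "0 < joint_density n x"
  unfolding joint_density_def by (intro prod_pos normal_density_pos) (simp add: pvar_pos)

lemma predictor_measurable:
  assumes "{0<..<k} \<subseteq> I"
  shows "predictor k \<in> borel_measurable (PiM I (\<lambda>_. lborel))"
proof -
  have "(\<lambda>x. x j) \<in> borel_measurable (PiM I (\<lambda>_. lborel :: real measure))" if "j \<in> {0<..<k}" for j
    using measurable_component_singleton[of j I "\<lambda>_. lborel :: real measure"] subsetD[OF assms that] by simp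
  then show ?thesis
    unfolding predictor_def
    by (intro borel_measurable_diff borel_measurable_sum borel_measurable_times) auto
qed

lemma joint_density_measurable [measurable]:
  "joint_density n \<in> borel_measurable (PiM {1..n} (\<lambda>_. lborel))"
proof -
  have "(\<lambda>x. normal_density (predictor k x) s (x k)) \<in> borel_measurable (PiM {1..n} (\<lambda>_. lborel))"
    if "k \<in> {1..n}" for k s
  proof -
    have [measurable]: "(\<lambda>x. x k) \<in> borel_measurable (PiM {1..n} (\<lambda>_. lborel :: real measure))"
      using measurable_component_singleton[of k "{1..n}" "\<lambda>_. lborel :: real measure"] that by auto
    have [measurable]: "predictor k \<in> borel_measurable (PiM {1..n} (\<lambda>_. lborel))"
      using that by (intro predictor_measurable) auto
    show ?thesis unfolding normal_density_def by measurable
  qed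
  then show ?thesis unfolding joint_density_def by (intro borel_measurable_prod) auto
qed

lemma joint_density_Suc:
  "joint_density (Suc n) (x(Suc n := y))
     = joint_density n x * normal_density (predictor (Suc n) x) (sqrt (pvar {1..n} (Suc n))) y"
proof -
  have pred: "predictor k (x(Suc n := y)) = predictor k x" if "k \<le> Suc n" for k
    unfolding predictor_def using that by (auto intro!: sum.cong)
  have "{0<..<Suc n} = {1..n}" by auto
  then show ?thesis
    unfolding joint_density_def by (simp add: pred cong: prod.cong) (auto intro!: prod.cong simp: pred)
qed

interpretation P: product_sigma_finite "\<lambda>_::nat. lborel :: real measure"
  by standard

text \<open>The last coordinate enters only through its conditional density given the earlier ones,
  which integrates to 1.\<close>

lemma nn_integral_joint_density:
  "(\<integral>\<^sup>+ x. ennreal (joint_density n x) \<partial>PiM {1..n} (\<lambda>_. lborel)) = 1"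
proof (induction n)
  case 0
  then show ?case by (simp add: PiM_empty joint_density_def)
next
  case (Suc n)
  have "{0<..<Suc n} = {1..n}" by auto
  then have s: "0 < sqrt (pvar {1..n} (Suc n))"
    using pvar_pos[of "Suc n"] by simp
  have one: "(\<integral>\<^sup>+ y. ennreal (normal_density m (sqrt (pvar {1..n} (Suc n))) y) \<partial>lborel) = 1" for m
    using s by (subst nn_integral_eq_integral) auto
  have ins: "{1..Suc n} = insert (Suc n) {1..n}" by auto
  have "(\<integral>\<^sup>+ x. ennreal (joint_density (Suc n) x) \<partial>PiM {1..Suc n} (\<lambda>_. lborel))
    = (\<integral>\<^sup>+ x. (\<integral>\<^sup>+ y. ennreal (joint_density (Suc n) (x(Suc n := y))) \<partial>lborel) \<partial>PiM {1..n} (\<lambda>_. lborel))"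
    using joint_density_measurable[of "Suc n"] unfolding ins
    by (subst P.product_nn_integral_insert) auto
  also have "\<dots> = (\<integral>\<^sup>+ x. ennreal (joint_density n x) \<partial>PiM {1..n} (\<lambda>_. lborel))"
    unfolding joint_density_Suc using joint_density_pos
    by (simp add: ennreal_mult less_imp_le nn_integral_cmult one del: One_nat_def)
  finally show ?case using Suc by simp
qed

lemma integrable_joint_density: "integrable (PiM {1..n} (\<lambda>_. lborel)) (joint_density n)"
  using nn_integral_joint_density[of n] joint_density_pos[of n] joint_density_measurable[of n]
  by (intro integrableI_nonneg) (auto simp: less_imp_le)

text \<open>Integrating out the last coordinate yields the characteristic function of its
  conditional law, whose mean is affine in the earlier coordinates. So the earlier frequencies
  change to \<open>t'\<close>, and the quadratic form splits along the innovation in the same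
  way.\<close>

lemma char_joint_density:
  "(CLINT x|PiM {1..n} (\<lambda>_. lborel). joint_density n x *\<^sub>R iexp (\<Sum>j\<in>{1..n}. t j * x j))
     = iexp (\<Sum>j\<in>{1..n}. t j * mean j) * exp (- form {1..n} t t / 2)"
proof (induction n arbitrary: t)
  case 0
  then show ?case
    by (simp add: joint_density_def form_def PiM_empty lebesgue_integral_count_space_finite)
next
  case (Suc n)
  let ?k = "Suc n"
  define e where "e = innov {1..n} ?k"
  define s where "s = pvar {1..n} ?k"
  have iv: "{0<..<?k} = {1..n}" and ins: "{1..?k} = insert ?k {1..n}" by auto
  have s: "0 < s" using pvar_pos[of ?k] unfolding iv s_def .
  have I: "is_innovation {1..n} ?k e" unfolding e_def by (intro is_innovation_innov) auto
  \<comment> \<open>As \<open>e ?k = 1\<close>, subtracting this multiple of the innovation makes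
    the last coefficient vanish.\<close>
  define t' where "t' = (\<lambda>j. t j - t ?k * e j)"
  have form_eq: "form {1..?k} t t = form {1..n} t' t' + t ?k ^ 2 * s"
  proof -
    have tk: "t' ?k = 0" using I by (simp add: t'_def is_innovation_def)
    have "form {1..?k} e t' = 0"
      using tk by (intro innovation_orthogonal[OF I]) (auto simp: le_Suc_eq)
    moreover have "form {1..?k} e e = s"
      unfolding s_def by (intro innovation_pvar[OF I]) auto
    moreover have "form {1..?k} t' t' = form {1..n} t' t'"
      using tk by (intro form_mono_neutral) (auto simp: le_Suc_eq)
    moreover have "form {1..?k} t t = form {1..?k} t' t' + 2 * t ?k * form {1..?k} e t' + t ?k ^ 2 * form {1..?k} e e"
    proof -
      have t: "t = (\<lambda>j. t' j + t ?k * e j)" by (simp add: t'_def)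
      have sc: "form {1..?k} (\<lambda>j. t ?k * e j) d = t ?k * form {1..?k} e d" for d
        by (rule form_scale_left)
      have "form {1..?k} t t = form {1..?k} t' t + t ?k * form {1..?k} e t"
        by (subst (1) t) (simp only: form_add_left sc)
      moreover have "form {1..?k} d t = form {1..?k} t' d + t ?k * form {1..?k} e d" for d
        by (subst form_commute, subst t) (simp only: form_add_left sc)
      ultimately show ?thesis
        using form_commute[of "{1..?k}" t' e] by (simp add: power2_eq_square algebra_simps)
    qed
    ultimately show ?thesis by simp
  qed
  have pred: "predictor ?k x = mean ?k - (\<Sum>j\<in>{1..n}. e j * (x j - mean j))" for x
    unfolding predictor_def iv e_def ..
  \<comment> \<open>Collects the constants that the means in the predictor leave behind.\<close>
  define a where "a = t ?k * mean ?k + (\<Sum>j\<in>{1..n}. t ?k * e j * mean j)"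
  have lin: "(\<Sum>j\<in>{1..n}. t j * x j) + t ?k * predictor ?k x = (\<Sum>j\<in>{1..n}. t' j * x j) + a" for x
    unfolding pred t'_def a_def
    by (simp add: algebra_simps sum.distrib sum_subtractf sum_distrib_left)
  have mean_eq: "(\<Sum>j\<in>{1..n}. t' j * mean j) + a = (\<Sum>j\<in>{1..?k}. t j * mean j)"
    unfolding t'_def a_def by (simp add: algebra_simps sum_subtractf)
  let ?f = "\<lambda>x. joint_density ?k x *\<^sub>R iexp (\<Sum>j\<in>{1..?k}. t j * x j)"
  have comp: "(\<lambda>x. x j) \<in> borel_measurable (PiM {1..?k} (\<lambda>_. lborel :: real measure))" if "j \<in> {1..?k}" for j
    using measurable_component_singleton[of j "{1..?k}" "\<lambda>_. lborel :: real measure"] that by auto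
  have "(\<lambda>x. \<Sum>j\<in>{1..?k}. t j * x j) \<in> borel_measurable (PiM {1..?k} (\<lambda>_. lborel :: real measure))"
    using comp by (intro borel_measurable_sum borel_measurable_times) auto
  then have f: "?f \<in> borel_measurable (PiM {1..?k} (\<lambda>_. lborel))"
    using joint_density_measurable[of ?k] by measurable
  have "integrable (PiM {1..?k} (\<lambda>_. lborel)) ?f"
    by (rule Bochner_Integration.integrable_bound[OF integrable_joint_density[of ?k] f]) auto
  then have "(CLINT x|PiM {1..?k} (\<lambda>_. lborel). ?f x)
      = (CLINT x|PiM {1..n} (\<lambda>_. lborel). (CLINT y|lborel. ?f (x(?k := y))))"
    unfolding ins by (intro P.product_integral_insert) auto
  also have "\<dots> = (CLINT x|PiM {1..n} (\<lambda>_. lborel).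
      iexp a * exp (- (t ?k ^ 2 * s) / 2) * (joint_density n x *\<^sub>R iexp (\<Sum>j\<in>{1..n}. t' j * x j)))"
  proof (rule Bochner_Integration.integral_cong[OF refl])
    fix x :: "nat \<Rightarrow> real"
    have "(\<Sum>j\<in>{1..?k}. t j * (x(?k := y)) j) = (\<Sum>j\<in>{1..n}. t j * x j) + t ?k * y" for y
      by (simp cong: sum.cong) (auto intro!: sum.cong)
    then have f_eq: "?f (x(?k := y)) = (joint_density n x *\<^sub>R iexp (\<Sum>j\<in>{1..n}. t j * x j)) *
        (normal_density (predictor ?k x) (sqrt s) y *\<^sub>R iexp (t ?k * y))" for y
      unfolding joint_density_Suc s_def by (simp add: distrib_left exp_add scaleR_conv_of_real mult_ac del: sum.cl_ivl_Suc)
    have "(CLINT y|lborel. ?f (x(?k := y))) = (joint_density n x *\<^sub>R iexp (\<Sum>j\<in>{1..n}. t j * x j)) *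
        (iexp (t ?k * predictor ?k x) * exp (- (t ?k ^ 2 * s) / 2))"
    proof -
      have "(CLINT y|lborel. normal_density (predictor ?k x) (sqrt s) y *\<^sub>R iexp (t ?k * y))
          = iexp (t ?k * predictor ?k x) * exp (- (t ?k ^ 2 * s) / 2)"
        using char_normal_density[of "sqrt s" "predictor ?k x" "t ?k"] s by simp
      then show ?thesis unfolding f_eq integral_mult_right_zero by (rule arg_cong)
    qed
    also have "\<dots> = joint_density n x *\<^sub>R iexp ((\<Sum>j\<in>{1..n}. t j * x j) + t ?k * predictor ?k x) * exp (- (t ?k ^ 2 * s) / 2)"
      by (simp add: distrib_left exp_add scaleR_conv_of_real mult_ac)
    also have "\<dots> = iexp a * exp (- (t ?k ^ 2 * s) / 2) * (joint_density n x *\<^sub>R iexp (\<Sum>j\<in>{1..n}. t' j * x j))"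
      unfolding lin by (simp add: distrib_left exp_add scaleR_conv_of_real mult_ac)
    finally show "(CLINT y|lborel. ?f (x(?k := y)))
      = iexp a * exp (- (t ?k ^ 2 * s) / 2) * (joint_density n x *\<^sub>R iexp (\<Sum>j\<in>{1..n}. t' j * x j))" .
  qed
  also have "\<dots> = iexp a * exp (- (t ?k ^ 2 * s) / 2) *
      (iexp (\<Sum>j\<in>{1..n}. t' j * mean j) * exp (- form {1..n} t' t' / 2))"
    unfolding Suc.IH[symmetric] by (rule integral_mult_right_zero)
  also have "\<dots> = iexp ((\<Sum>j\<in>{1..n}. t' j * mean j) + a) * exp (- form {1..?k} t t / 2)"
  proof -
    have "exp (- form {1..?k} t t / 2) = exp (- (t ?k ^ 2 * s) / 2) * exp (- form {1..n} t' t' / 2)"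
      unfolding form_eq exp_add[symmetric] by (simp add: add_divide_distrib)
    moreover have "iexp (u + a) = iexp u * iexp a" for u
      by (simp add: distrib_left exp_add)
    ultimately show ?thesis by (simp only: of_real_mult mult_ac)
  qed
  finally show ?case unfolding mean_eq .
qed

text \<open>By \<open>char_linear_combination\<close> and \<open>char_joint_density\<close> the law
  of the block and the candidate density have the same characteristic function, which determines a
  finite measure on the product.\<close>

lemma distributed_joint_density:
  "distributed M (PiM {1..n} (\<lambda>_. lborel)) (\<lambda>\<omega>. \<lambda>i\<in>{1..n}. X i \<omega>) (\<lambda>x. ennreal (joint_density n x))"
proof -
  let ?P = "PiM {1..n} (\<lambda>_. lborel :: real measure)"
  let ?Y = "\<lambda>\<omega>. \<lambda>i\<in>{1..n}. X i \<omega>"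
  \<comment> \<open>\<open>char_PiM_unique\<close> is stated over \<open>borel\<close>, the density
    over \<open>lborel\<close>; only the measurable sets have to agree.\<close>
  have sets: "sets ?P = sets (PiM {1..n} (\<lambda>_. borel))" by (intro sets_PiM_cong) auto
  have Y [measurable]: "?Y \<in> measurable M ?P"
    using X_measurable by (intro measurable_restrict) auto
  have lin [measurable]: "(\<lambda>x. \<Sum>j\<in>{1..n}. t j * x j) \<in> borel_measurable ?P" for t
    using measurable_component_singleton[of _ "{1..n}" "\<lambda>_. lborel :: real measure"]
    by (intro borel_measurable_sum borel_measurable_times) auto
  have "distr M ?P ?Y = density ?P (\<lambda>x. ennreal (joint_density n x))"
  proof (rule char_PiM_unique[of "{1..n}"])
    show "finite_measure (distr M ?P ?Y)" by (intro finite_measure_distr) (rule Y)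
    show "finite_measure (density ?P (\<lambda>x. ennreal (joint_density n x)))"
      using nn_integral_joint_density[of n] joint_density_measurable[of n]
      by (intro finite_measureI) (simp add: emeasure_density del: One_nat_def cong: nn_integral_cong)
    fix t
    have "(CLINT x|distr M ?P ?Y. iexp (\<Sum>i\<in>{1..n}. t i * x i)) = (CLINT \<omega>|M. iexp (\<Sum>i\<in>{1..n}. t i * X i \<omega>))"
    proof -
      have "(\<Sum>i\<in>{1..n}. t i * ?Y \<omega> i) = (\<Sum>i\<in>{1..n}. t i * X i \<omega>)" for \<omega>
        by (intro sum.cong) auto
      moreover have "(\<lambda>x. iexp (\<Sum>i\<in>{1..n}. t i * x i)) \<in> borel_measurable ?P"
        by measurable
      ultimately show ?thesis by (simp only: integral_distr[OF Y])
    qed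
    also have "\<dots> = (CLINT x|?P. joint_density n x *\<^sub>R iexp (\<Sum>j\<in>{1..n}. t j * x j))"
      unfolding char_joint_density by (intro char_linear_combination) auto
    also have "\<dots> = (CLINT x|density ?P (\<lambda>x. ennreal (joint_density n x)). iexp (\<Sum>i\<in>{1..n}. t i * x i))"
      by (subst integral_density) (auto simp: joint_density_pos less_imp_le simp del: One_nat_def)
    finally show "(CLINT x|distr M ?P ?Y. iexp (\<Sum>i\<in>{1..n}. t i * x i))
      = (CLINT x|density ?P (\<lambda>x. ennreal (joint_density n x)). iexp (\<Sum>i\<in>{1..n}. t i * x i))" .
  qed (use sets in auto)
  then show ?thesis unfolding distributed_def by (auto simp del: One_nat_def)
qed

text \<open>Evaluated at the sample, the logarithm of the density is a sum over the innovations.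
  Each has expected square equal to its prediction variance, which produces the constant 1 next to
  the logarithm.\<close>

theorem block_entropy_eq:
  "block_entropy M X n = (\<Sum>k\<in>{1..n}. (ln (2 * pi * pvar {0<..<k} k) + 1) / 2)"
proof (cases "n = 0")
  case False
  interpret information_space M "exp 1" by unfold_locales simp
  let ?P = "PiM {1..n} (\<lambda>_. lborel :: real measure)"
  let ?s = "\<lambda>k. pvar {0<..<k} k"
  let ?Y = "\<lambda>\<omega>. \<lambda>i\<in>{1..n}. X i \<omega>"
  \<comment> \<open>The innovation as a random variable; the range includes \<open>k\<close> itself,
    with coefficient 1.\<close>
  let ?R = "\<lambda>k \<omega>. \<Sum>j\<in>{0<..k}. innov {0<..<k} k j * (X j \<omega> - mean j)"
  have res: "X k \<omega> - predictor k (?Y \<omega>) = ?R k \<omega>" if "k \<in> {1..n}" for k \<omega>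
  proof -
    have "innov {0<..<k} k k = 1"
      using is_innovation_innov[of "{0<..<k}" k] by (simp add: is_innovation_def)
    moreover have "{0<..k} = insert k {0<..<k}" using that by auto
    moreover have "(\<Sum>j\<in>{0<..<k}. innov {0<..<k} k j * (?Y \<omega> j - mean j))
        = (\<Sum>j\<in>{0<..<k}. innov {0<..<k} k j * (X j \<omega> - mean j))"
      using that by (intro sum.cong) auto
    ultimately show ?thesis by (simp add: predictor_def)
  qed
  have ln_eq: "ln (joint_density n (?Y \<omega>)) = (\<Sum>k\<in>{1..n}. - ln (2 * pi * ?s k) / 2 - (?R k \<omega>)\<^sup>2 / (2 * ?s k))" for \<omega>
  proof -
    have nz: "normal_density a (sqrt (?s k)) b \<noteq> 0" for a b k
      using normal_density_pos[of "sqrt (?s k)" a b] pvar_pos[of k] by simp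
    have "ln (joint_density n (?Y \<omega>))
        = (\<Sum>k\<in>{1..n}. ln (normal_density (predictor k (?Y \<omega>)) (sqrt (?s k)) (?Y \<omega> k)))"
      unfolding joint_density_def
      by (intro ln_prod) (auto simp: nz)
    also have "\<dots> = (\<Sum>k\<in>{1..n}. - ln (2 * pi * ?s k) / 2 - (?R k \<omega>)\<^sup>2 / (2 * ?s k))"
      by (intro sum.cong refl, subst ln_normal_density[OF pvar_pos]) (simp flip: res)
    finally show ?thesis .
  qed
  have R: "integrable M (\<lambda>\<omega>. (?R k \<omega>)\<^sup>2)" "expectation (\<lambda>\<omega>. (?R k \<omega>)\<^sup>2) = ?s k" if "k \<in> {1..n}" for k
  proof -
    have "insert k {0<..<k} = {0<..k}" using that by auto
    moreover have "{0<..k} \<subseteq> {1..}" by auto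
    ultimately show "integrable M (\<lambda>\<omega>. (?R k \<omega>)\<^sup>2)" "expectation (\<lambda>\<omega>. (?R k \<omega>)\<^sup>2) = ?s k"
      using expectation_square[of "{0<..k}" "innov {0<..<k} k"] by (simp_all add: pvar_def)
  qed
  have "block_entropy M X n = - (\<integral>x. joint_density n x * ln (joint_density n x) \<partial>?P)"
    using entropy_distr[OF distributed_joint_density[of n]] joint_density_pos[of n] False
    by (simp add: block_entropy_def less_imp_le log_def)
  also have "(\<integral>x. joint_density n x * ln (joint_density n x) \<partial>?P) = expectation (\<lambda>\<omega>. ln (joint_density n (?Y \<omega>)))"
    using joint_density_pos[of n]
    by (intro distributed_integral[OF distributed_joint_density[of n]]) (auto simp: less_imp_le simp del: One_nat_def)
  also have "\<dots> = (\<Sum>k\<in>{1..n}. - ln (2 * pi * ?s k) / 2 - ?s k / (2 * ?s k))"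
    unfolding ln_eq using R by (simp add: prob_space)
  also have "- \<dots> = (\<Sum>k\<in>{1..n}. (ln (2 * pi * ?s k) + 1) / 2)"
    unfolding sum_negf[symmetric] using pvar_pos
    by (intro sum.cong) (auto simp: less_imp_neq[symmetric] field_simps)
  finally show ?thesis .
qed (simp add: block_entropy_def)

end

section \<open>Spectral densities bounded away from zero and the excess entropy\<close>

text \<open>The autocovariance is real, so the real part of the Fourier integral carries it;
  continuity provides integrability.\<close>

lemma spectral_density_cos:
  assumes "is_spectral_density r f" "continuous_on UNIV f"
  shows "2 * pi * r (nat \<bar>k\<bar>) = (LINT x:{0..2 * pi}|lborel. f x * cos (of_int k * x))"
proof -
  let ?g = "\<lambda>x. complex_of_real (f x) * exp (- (\<i> * complex_of_real x * of_int k))"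
  have "continuous_on {0..2 * pi} ?g"
    using assms(2) by (intro continuous_intros continuous_on_subset[OF assms(2)]) auto
  then have int: "integrable lborel (\<lambda>x. indicat_real {0..2 * pi} x *\<^sub>R ?g x)"
    using borel_integrable_atLeastAtMost'[of 0 "2 * pi" ?g] by (simp add: set_integrable_def)
  have Re: "Re (indicat_real {0..2 * pi} x *\<^sub>R ?g x) = indicat_real {0..2 * pi} x *\<^sub>R (f x * cos (of_int k * x))" for x
    by (simp add: Re_exp mult.commute)
  have "complex_of_real (2 * pi * r (nat \<bar>k\<bar>)) = (LINT x:{0..2 * pi}|lborel. ?g x)"
    using assms(1) by (simp add: is_spectral_density_def)
  then have "2 * pi * r (nat \<bar>k\<bar>) = Re (LINT x:{0..2 * pi}|lborel. ?g x)"
    by (metis Re_complex_of_real)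
  also have "\<dots> = (LINT x:{0..2 * pi}|lborel. f x * cos (of_int k * x))"
    unfolding set_lebesgue_integral_def integral_Re[OF int, symmetric] Re ..
  finally show ?thesis .
qed

lemma set_integral_cos_int:
  "(LINT x:{0..2 * pi}|lborel. cos (of_int k * x)) = (if k = 0 then 2 * pi else 0)"
proof (cases "k = 0")
  case False
  have "(LINT x:{0..2 * pi}|lborel. cos (of_int k * x))
      = sin (of_int k * (2 * pi)) / of_int k - sin (of_int k * 0) / of_int k"
    unfolding set_lebesgue_integral_def
    using False
    by (intro integral_FTC_atLeastAtMost[of 0 "2 * pi" "\<lambda>x. sin (of_int k * x) / of_int k"] continuous_intros)
      (auto intro!: derivative_eq_intros simp: has_real_derivative_iff_has_vector_derivative[symmetric])
  moreover have "sin (of_int k * (2 * pi)) = 0"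
    using sin_int_2pin[of k] by (simp add: mult_ac)
  ultimately show ?thesis using False by simp
qed (simp add: set_lebesgue_integral_def)

text \<open>The double sum is the squared modulus of the sum of
  \<open>c i * exp (\<i> * a i)\<close>, written with real and imaginary parts.\<close>

lemma sum_cos_diff_nonneg:
  "0 \<le> (\<Sum>i\<in>J. \<Sum>j\<in>J. c i * c j * cos (a i - a j :: real))"
proof -
  have "(\<Sum>i\<in>J. \<Sum>j\<in>J. c i * c j * cos (a i - a j)) = (\<Sum>i\<in>J. c i * cos (a i))\<^sup>2 + (\<Sum>i\<in>J. c i * sin (a i))\<^sup>2"
    by (simp add: cos_diff power2_eq_square sum_product algebra_simps sum.distrib)
  then show ?thesis by simp
qed

text \<open>Up to the factor \<open>2 * pi\<close>, the covariance form is the integral of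
  \<open>f\<close> against the squared modulus \<open>Q\<close> of the trigonometric polynomial with
  coefficients \<open>c\<close>, and \<open>f\<close> may be replaced by its lower bound
  \<open>m\<close>.\<close>

lemma spectral_density_coercive:
  assumes r: "is_spectral_density r f" and f: "continuous_on UNIV f"
    and m: "0 < m" "\<And>x. x \<in> {0..2 * pi} \<Longrightarrow> m \<le> f x"
  shows "coercive_kernel (\<lambda>i j. r (nat \<bar>int i - int j\<bar>)) m"
proof
  fix J :: "nat set" and c :: "nat \<Rightarrow> real"
  assume J: "finite J"
  define Q where "Q = (\<lambda>x. \<Sum>i\<in>J. \<Sum>j\<in>J. c i * c j * cos (of_int (int i - int j) * x))"
  have Q0: "0 \<le> Q x" for x
    using sum_cos_diff_nonneg[of c "\<lambda>i. real i * x" J] by (simp add: Q_def algebra_simps)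
  have int: "set_integrable lborel {0..2 * pi} g" if "continuous_on UNIV g" for g :: "real \<Rightarrow> real"
    using that by (intro borel_integrable_atLeastAtMost' continuous_on_subset[OF that]) auto
  \<comment> \<open>Used for \<open>g = f\<close>, where the cosine integrals are autocovariances,
    and for \<open>g = 1\<close>, where orthogonality leaves only the diagonal.\<close>
  have swap: "(LINT x:{0..2 * pi}|lborel. g x * Q x)
      = (\<Sum>i\<in>J. \<Sum>j\<in>J. c i * c j * (LINT x:{0..2 * pi}|lborel. g x * cos (of_int (int i - int j) * x)))"
    if g: "continuous_on UNIV g" for g
  proof -
    have "g x * Q x = (\<Sum>i\<in>J. \<Sum>j\<in>J. c i * c j * (g x * cos (of_int (int i - int j) * x)))" for x
      by (simp add: Q_def sum_distrib_left mult_ac)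
    moreover have "integrable lborel (\<lambda>x. indicat_real {0..2 * pi} x *\<^sub>R (g x * cos (k * x)))" for k
      unfolding set_integrable_def[symmetric] by (intro int continuous_intros g)
    ultimately show ?thesis
      unfolding set_lebesgue_integral_def
      by (simp add: sum_distrib_left mult.left_commute[of "indicat_real _ _"])
  qed
  have "2 * pi * (\<Sum>i\<in>J. \<Sum>j\<in>J. c i * c j * r (nat \<bar>int i - int j\<bar>))
      = (\<Sum>i\<in>J. \<Sum>j\<in>J. c i * c j * (2 * pi * r (nat \<bar>int i - int j\<bar>)))"
    by (simp add: sum_distrib_left mult_ac)
  also have "\<dots> = (LINT x:{0..2 * pi}|lborel. f x * Q x)"
    by (simp only: swap[OF f] spectral_density_cos[OF r f])
  also have "\<dots> \<ge> (LINT x:{0..2 * pi}|lborel. m * Q x)"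
  proof (rule set_integral_mono)
    have "continuous_on UNIV Q" unfolding Q_def by (intro continuous_intros)
    then show "set_integrable lborel {0..2 * pi} (\<lambda>x. m * Q x)" "set_integrable lborel {0..2 * pi} (\<lambda>x. f x * Q x)"
      by (auto intro!: int continuous_intros f)
  qed (use m Q0 in \<open>auto intro!: mult_right_mono\<close>)
  also have "(LINT x:{0..2 * pi}|lborel. m * Q x)
      = m * (\<Sum>i\<in>J. \<Sum>j\<in>J. c i * c j * (if i = j then 2 * pi else 0))"
  proof -
    have "(LINT x:{0..2 * pi}|lborel. Q x)
        = (\<Sum>i\<in>J. \<Sum>j\<in>J. c i * c j * (LINT x:{0..2 * pi}|lborel. cos (of_int (int i - int j) * x)))"
      using swap[of "\<lambda>_. 1"] by (simp only: mult_1 continuous_on_const)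
    then show ?thesis by (simp only: set_integral_cos_int set_integral_mult_right) simp
  qed
  also have "(\<Sum>i\<in>J. \<Sum>j\<in>J. c i * c j * (if i = j then 2 * pi else 0)) = 2 * pi * (\<Sum>i\<in>J. (c i)\<^sup>2)"
    using J by (simp add: if_distrib sum.delta power2_eq_square sum_distrib_left mult_ac cong: if_cong)
  finally show "m * (\<Sum>i\<in>J. (c i)\<^sup>2) \<le> (\<Sum>i\<in>J. \<Sum>j\<in>J. c i * c j * r (nat \<bar>int i - int j\<bar>))"
    by (simp add: mult_ac)
qed (use m in \<open>auto simp: abs_minus_commute\<close>)

text \<open>For \<open>j \<le> m < k\<close> the lag \<open>k - j\<close> is at least
  \<open>m - j\<close> and at least \<open>k - m\<close>. Monotonicity thus splits each square into
  one factor per side of \<open>m\<close>, and the double sum factors into two partial sums of the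
  series.\<close>

lemma sum_square_le_of_decseq:
  fixes r :: "nat \<Rightarrow> real"
  assumes dec: "decseq (\<lambda>n. \<bar>r n\<bar>)" and sum: "summable (\<lambda>n. \<bar>r n\<bar>)"
  shows "(\<Sum>j\<in>{0<..m}. \<Sum>k\<in>{m<..l}. (r (nat \<bar>int j - int k\<bar>))\<^sup>2) \<le> (\<Sum>n. \<bar>r n\<bar>)\<^sup>2"
proof -
  have le: "(r (nat \<bar>int j - int k\<bar>))\<^sup>2 \<le> \<bar>r (m - j)\<bar> * \<bar>r (k - m)\<bar>" if "j \<in> {0<..m}" "k \<in> {m<..l}" for j k
  proof -
    have eq: "nat \<bar>int j - int k\<bar> = k - j" and "m - j \<le> k - j" "k - m \<le> k - j" using that by auto
    then have "\<bar>r (k - j)\<bar> * \<bar>r (k - j)\<bar> \<le> \<bar>r (m - j)\<bar> * \<bar>r (k - m)\<bar>"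
      using decseqD[OF dec] by (intro mult_mono) auto
    then show ?thesis unfolding eq by (simp add: power2_eq_square)
  qed
  have bound: "(\<Sum>j\<in>A. \<bar>r (h j)\<bar>) \<le> (\<Sum>n. \<bar>r n\<bar>)" if "finite A" "inj_on h A" for A :: "nat set" and h
    using sum_le_suminf[OF sum, of "h ` A"] that by (simp add: sum.reindex)
  have "(\<Sum>j\<in>{0<..m}. \<Sum>k\<in>{m<..l}. (r (nat \<bar>int j - int k\<bar>))\<^sup>2)
      \<le> (\<Sum>j\<in>{0<..m}. \<Sum>k\<in>{m<..l}. \<bar>r (m - j)\<bar> * \<bar>r (k - m)\<bar>)"
    by (intro sum_mono le)
  also have "\<dots> = (\<Sum>j\<in>{0<..m}. \<bar>r (m - j)\<bar>) * (\<Sum>k\<in>{m<..l}. \<bar>r (k - m)\<bar>)"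
    by (simp add: sum_product)
  also have "\<dots> \<le> (\<Sum>n. \<bar>r n\<bar>) * (\<Sum>n. \<bar>r n\<bar>)"
    using sum by (intro mult_mono bound sum_nonneg suminf_nonneg) (auto intro!: inj_onI)
  finally show ?thesis by (simp add: power2_eq_square)
qed

text \<open>The excesses over \<open>l\<close> have convergent partial sums, so their average tends
  to 0.\<close>

lemma mean_tendsto_of_summable_increments:
  fixes h :: "nat \<Rightarrow> real"
  assumes "summable (\<lambda>n. h (Suc n) - l)"
  shows "(\<lambda>n. (\<Sum>k\<in>{1..n}. h k) / real n) \<longlonglongrightarrow> l"
proof -
  have "(\<lambda>n. (\<Sum>i<n. h (Suc i) - l) * inverse (real n)) \<longlonglongrightarrow> (\<Sum>n. h (Suc n) - l) * 0"
    by (intro tendsto_mult summable_LIMSEQ assms lim_inverse_n)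
  then have "(\<lambda>n. l + (\<Sum>i<n. h (Suc i) - l) * inverse (real n)) \<longlonglongrightarrow> l + 0"
    by (intro tendsto_add tendsto_const) simp
  moreover have "eventually (\<lambda>n. l + (\<Sum>i<n. h (Suc i) - l) * inverse (real n) = (\<Sum>k\<in>{1..n}. h k) / real n) sequentially"
  proof (rule eventually_sequentiallyI[of 1])
    fix n :: nat assume "1 \<le> n"
    moreover have "(\<Sum>k\<in>{1..n}. h k) = (\<Sum>i<n. h (Suc i))"
      using sum.atLeast1_atMost_eq[of h n] by simp
    ultimately show "l + (\<Sum>i<n. h (Suc i) - l) * inverse (real n) = (\<Sum>k\<in>{1..n}. h k) / real n"
      by (simp add: sum_subtractf field_simps)
  qed
  ultimately show ?thesis by (simp add: tendsto_cong)
qed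

text \<open>As \<open>lim\<close> and \<open>suminf\<close> are total, convergence of the quotients
  behind the entropy rate and of the series is asserted together with finiteness.\<close>

theorem theorem3p3:
  fixes M :: "'a measure"
    and X :: "nat \<Rightarrow> 'a \<Rightarrow> real"
    and r :: "nat \<Rightarrow> real"
    and f :: "real \<Rightarrow> real"
  assumes "prob_space M"
    and "gaussian_process M X"
    and "stationary_process M X"
    and "is_autocovariance M X r"
    and "decseq (\<lambda>n. \<bar>r n\<bar>)"
    and "is_spectral_density r f"
    and "continuous_on UNIV f"
    and "\<forall>x. f x > 0"
    and "summable (\<lambda>n. \<bar>r n\<bar>)"
  shows "convergent (\<lambda>n. block_entropy M X n / real n) \<and>
         summable (\<lambda>n. entropy_increment M X (Suc n) - entropy_rate M X) \<and>
         \<bar>excess_entropy M X\<bar> \<noteq> \<infinity>"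
proof -
  define \<rho> where "\<rho> = (\<lambda>i j. r (nat \<bar>int i - int j\<bar>))"
  \<comment> \<open>Compactness of one period turns pointwise positivity into a positive minimum
    \<open>f x0\<close>, which serves as coercivity constant.\<close>
  obtain x0 where "\<And>x. x \<in> {0..2 * pi} \<Longrightarrow> f x0 \<le> f x"
    using continuous_attains_inf[of "{0..2 * pi}" f] continuous_on_subset[OF assms(7)]
    by (metis atLeastAtMost_iff compact_Icc empty_iff order_refl pi_ge_zero subset_UNIV zero_le_mult_iff zero_le_numeral)
  then have ck: "coercive_kernel \<rho> (f x0)"
    unfolding \<rho>_def using assms(8) by (intro spectral_density_coercive[OF assms(6,7)]) auto
  interpret prob_space M by fact
  interpret nondegenerate_gaussian M \<rho> "f x0" X
  proof (intro nondegenerate_gaussian.intro nondegenerate_gaussian_axioms.intro ck assms(1,2))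
    fix i j :: nat assume ij: "1 \<le> i" "1 \<le> j"
    have cov: "r n = expectation (\<lambda>\<omega>. (X (k + n) \<omega> - expectation (X (k + n))) * (X k \<omega> - expectation (X k)))"
      if "1 \<le> k" for k n
      using assms(4) that unfolding is_autocovariance_def by blast
    show "\<rho> i j = expectation (\<lambda>\<omega>. (X i \<omega> - expectation (X i)) * (X j \<omega> - expectation (X j)))"
    proof (cases "j \<le> i")
      case True
      then have "nat \<bar>int i - int j\<bar> = i - j" by simp
      then show ?thesis using cov[of j "i - j"] ij True by (simp add: \<rho>_def)
    next
      case False
      then have "nat \<bar>int i - int j\<bar> = j - i" by simp
      then show ?thesis using cov[of i "j - i"] ij False by (simp add: \<rho>_def mult.commute)
    qed
  qed
  define s where "s = (\<lambda>k. pvar {0<..<k} k)"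
  have s_pos: "0 < s k" and s_ge: "f x0 \<le> s k" for k
    using pvar_pos[of k] pvar_ge[of "{0<..<k}" k] by (simp_all add: s_def)
  \<comment> \<open>The kernel depends only on the lag, so a window may start anywhere.\<close>
  have shift: "pvar {m<..<k + m} (k + m) = s k" for m k
    unfolding s_def by (intro pvar_shift[OF ck]) (simp add: \<rho>_def)
  \<comment> \<open>After translation \<open>s k\<close> is the error at \<open>Suc k\<close>
    without the predictor 1; adding that predictor cannot increase it.\<close>
  have dec: "s (Suc k) \<le> s k" if "1 \<le> k" for k
  proof -
    have "{1} \<union> {1<..<Suc k} = {0<..<Suc k}" using that by auto
    then show ?thesis
      using pvar_gap[of "{1}" "{1<..<Suc k}" "Suc k"] shift[of 1 k] that by (auto simp: s_def)
  qed
  \<comment> \<open>The bound from \<open>sum_pvar_gap_le\<close> with \<open>R = r 0\<close> and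
    \<open>sum_square_le_of_decseq\<close>; it depends on neither \<open>n\<close> nor
    \<open>m\<close>.\<close>
  define C where "C = r 0 / (f x0)\<^sup>2 * (\<Sum>n. \<bar>r n\<bar>)\<^sup>2"
  have gap: "(\<Sum>k<n. s (Suc k) - s (Suc k + m)) \<le> C" for n m
  proof -
    have r0: "0 \<le> r 0" using s_pos[of 0] pvar_le[of "{0<..<0}" 0] by (simp add: s_def \<rho>_def)
    \<comment> \<open>Shifted by \<open>m\<close>, the first variance uses only the second block as
      predictors, the other one both blocks.\<close>
    have "(\<Sum>k<n. s (Suc k) - s (Suc k + m)) = (\<Sum>k\<in>{m<..m + n}. pvar {m<..<k} k - pvar {0<..<k} k)"
    proof (rule sum.reindex_bij_witness[of _ "\<lambda>k. k - Suc m" "\<lambda>k. Suc k + m"])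
      show "pvar {m<..<Suc k + m} (Suc k + m) - pvar {0<..<Suc k + m} (Suc k + m) = s (Suc k) - s (Suc k + m)" for k
        by (simp only: shift) (simp add: s_def)
    qed auto
    also have "\<dots> \<le> r 0 / (f x0)\<^sup>2 * (\<Sum>j\<in>{0<..m}. \<Sum>k\<in>{m<..m + n}. (\<rho> j k)\<^sup>2)"
      by (intro sum_pvar_gap_le[OF ck]) (simp add: \<rho>_def)
    also have "\<dots> \<le> C"
      unfolding C_def \<rho>_def using r0 by (intro mult_left_mono sum_square_le_of_decseq assms) auto
    finally show ?thesis .
  qed
  have "decseq (\<lambda>k. s (Suc k))" using dec by (intro decseq_SucI) simp
  moreover have "f x0 \<le> s (Suc k)" for k by (rule s_ge)
  ultimately obtain L where L: "(\<lambda>k. s (Suc k)) \<longlonglongrightarrow> L" and sL: "\<And>k. L \<le> s (Suc k)"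
    using decseq_convergent[of "\<lambda>k. s (Suc k)" "f x0"] by blast
  have "f x0 \<le> L" using L s_ge by (intro LIMSEQ_le_const) auto
  then have L0: "0 < L" using assms(8) by (smt (verit))
  \<comment> \<open>In \<open>gap\<close>, \<open>m\<close> tends to infinity term by term while
    \<open>n\<close> stays fixed.\<close>
  have gapL: "(\<Sum>k<n. s (Suc k) - L) \<le> C" for n
  proof (rule LIMSEQ_le_const2)
    show "(\<lambda>m. \<Sum>k<n. s (Suc k) - s (Suc k + m)) \<longlonglongrightarrow> (\<Sum>k<n. s (Suc k) - L)"
    proof (intro tendsto_intros)
      fix k
      show "(\<lambda>m. s (Suc k + m)) \<longlonglongrightarrow> L"
        using LIMSEQ_ignore_initial_segment[OF L, of k] by (simp add: add_ac)
    qed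
  qed (use gap in auto)
  \<comment> \<open>\<open>h k\<close> will be the entropy increment at \<open>k\<close>, and
    \<open>h_inf\<close> the entropy rate.\<close>
  define h where "h = (\<lambda>k. (ln (2 * pi * s k) + 1) / 2)"
  define h_inf where "h_inf = (ln (2 * pi * L) + 1) / 2"
  have diff: "h (Suc k) - h_inf = (ln (s (Suc k)) - ln L) / 2" for k
    using s_pos[of "Suc k"] L0 by (simp add: h_def h_inf_def ln_mult field_simps)
  have summ: "summable (\<lambda>n. h (Suc n) - h_inf)"
  proof (rule summableI_nonneg_bounded)
    show "0 \<le> h (Suc n) - h_inf" for n
      unfolding diff using sL[of n] L0 by simp
    \<comment> \<open>The bound is half of \<open>ln s - ln L \<le> (s - L) / L\<close>, summed with
      \<open>gapL\<close>.\<close>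
    show "(\<Sum>k<n. h (Suc k) - h_inf) \<le> C / (2 * L)" for n
    proof -
      have "(\<Sum>k<n. h (Suc k) - h_inf) \<le> (\<Sum>k<n. (s (Suc k) - L) / (2 * L))"
      proof (rule sum_mono)
        fix k
        show "h (Suc k) - h_inf \<le> (s (Suc k) - L) / (2 * L)"
          unfolding diff using divide_right_mono[OF ln_diff_le[OF s_pos[of "Suc k"] L0], of 2]
          by (simp only: divide_divide_eq_left mult.commute[of 2])
      qed
      also have "\<dots> \<le> C / (2 * L)"
        unfolding sum_divide_distrib[symmetric] using gapL L0 by (intro divide_right_mono) auto
      finally show ?thesis .
    qed
  qed
  have H: "block_entropy M X n = (\<Sum>k\<in>{1..n}. h k)" for n
    unfolding block_entropy_eq h_def s_def ..
  have lim: "(\<lambda>n. block_entropy M X n / real n) \<longlonglongrightarrow> h_inf"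
    unfolding H by (rule mean_tendsto_of_summable_increments[OF summ])
  then have "entropy_rate M X = h_inf" unfolding entropy_rate_def by (rule limI)
  moreover have "entropy_increment M X (Suc n) = h (Suc n)" for n
    by (simp add: entropy_increment_def H)
  ultimately have eq: "entropy_increment M X (Suc n) - entropy_rate M X = h (Suc n) - h_inf" for n
    by simp
  have "excess_entropy M X = ereal (\<Sum>n. h (Suc n) - h_inf)"
    unfolding excess_entropy_def eq by (intro sums_unique[symmetric]) (simp add: sums_ereal summable_sums[OF summ])
  then show ?thesis
    using lim summ by (simp add: eq convergentI)
qed

end
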